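(* Under the standing setup below (in particular Assumptions 1 and 2, and the assumption that $\mathbf 1_{\Omega_n}\to 1$ almost surely), the operators $\widehat Q_{n,h}$ converge to $Q_h$ in operator norm on $W(\mathcal L(t))$: $$\big\|\widehat{Q}_{n,h}-Q_h\big\|_{W}:=\sup\Big\{\big\|\widehat Q_{n,h}g-Q_hg\big\|_W:\ g\in W(\mathcal L(t)),\ \|g\|_W\le 1\Big\}\longrightarrow 0\quad\text{almost surely as }n\to\infty.$$
   Context: Standing setup. Let $X_1,X_2,\dots$ be i.i.d. random vectors in $\mathbb R^d$ with common law $\mu$ having a Lebesgue density $f$. For $s\in\mathbb R$ let $\mathcal L(s)=\{x\in\mathbb R^d: f(x)\ge s\}$, and for $a\le b$ let $\mathcal L_a^b=\{x: a\le f(x)\le b\}$. A level $t>0$ in the interior of the range of $f$ is fixed; $\mathcal L(t)$ is nonempty and compact, with finitely many connected components $\mathcal C_1,\dots,\mathcal C_\ell$, and $d_{min}=\min_{i\neq j}\mathrm{dist}(\mathcal C_i,\mathcal C_j)$. Assumption 1: (i) $f$ is of class $C^2$ on $\mathbb R^d$; (ii) $\|D_xf\|>0$ on $\{x: f(x)=t\}$; (iii) $f$, $D_xf$, $D_x^2f$ are uniformly bounded on $\mathbb R^d$. $B$ denotes the unit ball of $\mathbb R^d$ centered at $0$. Assumption 2: $k:\mathbb R^d\to\mathbb R_+$ satisfies (i) $k$ is $C^2$; (ii) the support of $k$ is $B$; (iii) $k$ is bounded from below on $B/2$ by a positive number; (iv) $k(-x)=k(x)$. For $h>0$, $k_h(u)=k(u/h)$.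 Fix $h>0$ and $\varepsilon_0>0$ such that $\mathcal L_{t-\varepsilon_0}^{t+\varepsilon_0}$ contains no critical point of $f$ and $\varepsilon_0/\alpha(\varepsilon_0)<h/2$, where $\alpha(\varepsilon_0)=\inf\{\|D_xf(x)\|: x\in\mathcal L_{t-\varepsilon_0}^t\}$. Let $(\varepsilon_n)$ be positive numbers with $\varepsilon_n\le\varepsilon_0$ and $\varepsilon_n\to0$. Let $(\varphi_n)$ be $C^1$ diffeomorphisms of $\mathbb R^d$ with $\varphi_n(\mathcal L(t))=\mathcal L(t-\varepsilon_n)$, $\sup_{x\in\mathcal L(t)}\|\varphi_n(x)-x\|\to0$ and $\sup_{x\in\mathcal L(t)}\|D_x\varphi_n(x)-I_d\|\to0$. For $\mathcal D\subset\mathbb R^d$, $W(\mathcal D)$ is the Banach space of complex-valued bounded continuously differentiable functions on $\mathcal D$ with bounded gradient, with norm $\|g\|_W=\|g\|_\infty+\|D_xg\|_\infty$. Empirical objects. Let $\widehat f_n$ be a differentiable density estimate built from $X_1,\dots,X_n$; $\mathcal L_n(t)=\{x:\widehat f_n(x)\ge t\}$; $J(n)=\{j\in\{1,\dots,n\}:\widehat f_n(X_j)\ge t\}$, $j(n)=\#J(n)$, $\mathbb P_n^t=\frac1{j(n)}\sum_{j\in J(n)}\delta_{X_j}$. Let $\Omega_n=[\|\widehat f_n-f\|_\infty\le\varepsilon_n]\cap[\inf\{\|D_x\widehat f_n(x)\|: x\in\mathcal L_{t-\varepsilon_0}^{t+\varepsilon_0}\}\ge\frac12\|D_xf\|_\infty]$;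 it is assumed that $\mathbf 1_{\Omega_n}\to1$ almost surely. (On $\Omega_n$, $\mathcal L(t+\varepsilon_n)\subset\mathcal L_n(t)\subset\mathcal L(t-\varepsilon_n)$.) Set $K_{n,h}(x)=\int_{\mathcal L_n(t)}k_h(y-x)\,\mathbb P_n^t(dy)$ and $q_{n,h}(x,y)=k_h(y-x)/K_{n,h}(x)$ (with $0/0=0$). On $\Omega_n$, $\widehat Q_{n,h}:W(\mathcal L(t))\to W(\mathcal L(t))$ is defined by $\widehat Q_{n,h}g(x)=\int_{\mathcal L_n(t)}q_{n,h}(\varphi_n(x),y)\,g(\varphi_n^{-1}(y))\,\mathbb P_n^t(dy)$ for $x\in\mathcal L(t)$; on $\Omega_n^c$, $\widehat Q_{n,h}$ is the zero operator. Limit objects. $\mu^t$ is the conditional law of $X_1$ given $X_1\in\mathcal L(t)$; $K_h(x)=\int_{\mathcal L(t)}k_h(y-x)\,\mu^t(dy)$; $q_h(x,y)=k_h(y-x)/K_h(x)$; $Q_h:W(\mathcal L(t))\to W(\mathcal L(t))$, $Q_hg(x)=\int_{\mathcal L(t)}q_h(x,y)g(y)\,\mu^t(dy)$. *)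

theory Defs
  imports "HOL-Probability.Probability"
begin

definition lev :: "('a \<Rightarrow> real) \<Rightarrow> real \<Rightarrow> 'a set" where
  "lev f s = {x. s \<le> f x}"

definition band :: "('a \<Rightarrow> real) \<Rightarrow> real \<Rightarrow> real \<Rightarrow> 'a set" where
  "band f a b = {x. a \<le> f x \<and> f x \<le> b}"

definition kh :: "('a::real_normed_vector \<Rightarrow> real) \<Rightarrow> real \<Rightarrow> 'a \<Rightarrow> real" where
  "kh k h u = k (u /\<^sub>R h)"

definition inW :: "'a::euclidean_space set \<Rightarrow> ('a \<Rightarrow> complex) \<Rightarrow> bool" where
  "inW D g \<longleftrightarrow>
     (\<forall>x\<in>D. g differentiable (at x within D)) \<and>
     continuous_on D (\<lambda>x. Blinfun (frechet_derivative g (at x within D))) \<and>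
     bounded (g ` D) \<and>
     bounded ((\<lambda>x. Blinfun (frechet_derivative g (at x within D))) ` D)"

definition Wnorm :: "'a::euclidean_space set \<Rightarrow> ('a \<Rightarrow> complex) \<Rightarrow> real" where
  "Wnorm D g = (SUP x\<in>D. cmod (g x)) +
               (SUP x\<in>D. norm (Blinfun (frechet_derivative g (at x within D))))"

text \<open>Empirical objects. Samples X_1..X_n are X 0 .. X (n-1); the estimator
  fhat n is a function of the sample list.\<close>
definition sample :: "(nat \<Rightarrow> 'w \<Rightarrow> 'a) \<Rightarrow> nat \<Rightarrow> 'w \<Rightarrow> 'a list" where
  "sample X n \<omega> = map (\<lambda>i. X i \<omega>) [0..<n]"

definition Jn :: "(nat \<Rightarrow> 'a list \<Rightarrow> 'a \<Rightarrow> real) \<Rightarrow> (nat \<Rightarrow> 'w \<Rightarrow> 'a) \<Rightarrow> real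
                  \<Rightarrow> nat \<Rightarrow> 'w \<Rightarrow> nat set" where
  "Jn fhat X t n \<omega> = {j. j < n \<and> t \<le> fhat n (sample X n \<omega>) (X j \<omega>)}"

definition Pnt_int :: "(nat \<Rightarrow> 'a list \<Rightarrow> 'a \<Rightarrow> real) \<Rightarrow> (nat \<Rightarrow> 'w \<Rightarrow> 'a) \<Rightarrow> real
                  \<Rightarrow> nat \<Rightarrow> 'w \<Rightarrow> 'a set \<Rightarrow> ('a \<Rightarrow> 'b::real_vector) \<Rightarrow> 'b" where
  "Pnt_int fhat X t n \<omega> A u =
     (\<Sum>j\<in>Jn fhat X t n \<omega>. indicator A (X j \<omega>) *\<^sub>R u (X j \<omega>)) /\<^sub>R real (card (Jn fhat X t n \<omega>))"

definition Knh :: "(nat \<Rightarrow> 'a list \<Rightarrow> 'a \<Rightarrow> real) \<Rightarrow> (nat \<Rightarrow> 'w \<Rightarrow> 'a::real_normed_vector) \<Rightarrow> real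
                  \<Rightarrow> ('a \<Rightarrow> real) \<Rightarrow> real \<Rightarrow> nat \<Rightarrow> 'w \<Rightarrow> 'a \<Rightarrow> real" where
  "Knh fhat X t k h n \<omega> x =
     Pnt_int fhat X t n \<omega> (lev (fhat n (sample X n \<omega>)) t) (\<lambda>y. kh k h (y - x))"

definition qnh :: "(nat \<Rightarrow> 'a list \<Rightarrow> 'a \<Rightarrow> real) \<Rightarrow> (nat \<Rightarrow> 'w \<Rightarrow> 'a::real_normed_vector) \<Rightarrow> real
                  \<Rightarrow> ('a \<Rightarrow> real) \<Rightarrow> real \<Rightarrow> nat \<Rightarrow> 'w \<Rightarrow> 'a \<Rightarrow> 'a \<Rightarrow> real" where
  "qnh fhat X t k h n \<omega> x y = kh k h (y - x) / Knh fhat X t k h n \<omega> x"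

definition Omega_n :: "('a::real_normed_vector \<Rightarrow> real) \<Rightarrow> ('a \<Rightarrow> 'a \<Rightarrow>\<^sub>L real)
     \<Rightarrow> (nat \<Rightarrow> 'a list \<Rightarrow> 'a \<Rightarrow> real) \<Rightarrow> (nat \<Rightarrow> 'a list \<Rightarrow> 'a \<Rightarrow> 'a \<Rightarrow>\<^sub>L real)
     \<Rightarrow> (nat \<Rightarrow> 'w \<Rightarrow> 'a) \<Rightarrow> real \<Rightarrow> real \<Rightarrow> real \<Rightarrow> nat \<Rightarrow> 'w \<Rightarrow> bool" where
  "Omega_n f Df fhat Dfhat X t eps0 e n \<omega> \<longleftrightarrow>
     (\<forall>x. \<bar>fhat n (sample X n \<omega>) x - f x\<bar> \<le> e) \<and>
     (\<forall>x\<in>band f (t - eps0) (t + eps0).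
        (1/2) * (SUP y. norm (Df y)) \<le> norm (Dfhat n (sample X n \<omega>) x))"

definition Qhat :: "('a::real_normed_vector \<Rightarrow> real) \<Rightarrow> ('a \<Rightarrow> 'a \<Rightarrow>\<^sub>L real)
     \<Rightarrow> (nat \<Rightarrow> 'a list \<Rightarrow> 'a \<Rightarrow> real) \<Rightarrow> (nat \<Rightarrow> 'a list \<Rightarrow> 'a \<Rightarrow> 'a \<Rightarrow>\<^sub>L real)
     \<Rightarrow> (nat \<Rightarrow> 'w \<Rightarrow> 'a) \<Rightarrow> real \<Rightarrow> real \<Rightarrow> (nat \<Rightarrow> real)
     \<Rightarrow> ('a \<Rightarrow> real) \<Rightarrow> real \<Rightarrow> (nat \<Rightarrow> 'a \<Rightarrow> 'a)
     \<Rightarrow> nat \<Rightarrow> 'w \<Rightarrow> ('a \<Rightarrow> complex) \<Rightarrow> 'a \<Rightarrow> complex" where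
  "Qhat f Df fhat Dfhat X t eps0 eps k h phi n \<omega> g x =
     (if Omega_n f Df fhat Dfhat X t eps0 (eps n) n \<omega>
      then Pnt_int fhat X t n \<omega> (lev (fhat n (sample X n \<omega>)) t)
             (\<lambda>y. complex_of_real (qnh fhat X t k h n \<omega> (phi n x) y) * g (inv (phi n) y))
      else 0)"

definition mut :: "'w measure \<Rightarrow> (nat \<Rightarrow> 'w \<Rightarrow> 'a::euclidean_space) \<Rightarrow> 'a set \<Rightarrow> 'a measure" where
  "mut M X L = uniform_measure (distr M lborel (X 0)) L"

definition Kh :: "'a measure \<Rightarrow> 'a set \<Rightarrow> ('a::real_normed_vector \<Rightarrow> real) \<Rightarrow> real \<Rightarrow> 'a \<Rightarrow> real" where
  "Kh mu L k h x = (LINT y:L|mu. kh k h (y - x))"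

definition qh :: "'a measure \<Rightarrow> 'a set \<Rightarrow> ('a::real_normed_vector \<Rightarrow> real) \<Rightarrow> real \<Rightarrow> 'a \<Rightarrow> 'a \<Rightarrow> real" where
  "qh mu L k h x y = kh k h (y - x) / Kh mu L k h x"

definition Qh :: "'a measure \<Rightarrow> 'a set \<Rightarrow> ('a::real_normed_vector \<Rightarrow> real) \<Rightarrow> real
                  \<Rightarrow> ('a \<Rightarrow> complex) \<Rightarrow> 'a \<Rightarrow> complex" where
  "Qh mu L k h g x = (LINT y:L|mu. complex_of_real (qh mu L k h x y) * g y)"

end

theory Submission
  imports Defs
begin

text \<open>
  Write \<open>\<mu>\<close> for the law of the sample, \<open>L\<close> for the level set and \<open>\<kappa>\<close> for the rescaled kernel. All
  normalisations cancel, so that both operators are quotients: the limit operator maps \<open>g\<close> to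
  \<open>x \<mapsto> \<integral>\<^sub>L \<kappa>(y - x) g(y) \<mu>(dy) / \<integral>\<^sub>L \<kappa>(y - x) \<mu>(dy)\<close>, and the empirical one to the same expression
  with \<open>\<kappa>(X\<^sub>j - \<phi>\<^sub>n x)\<close>, \<open>g(\<phi>\<^sub>n\<^sup>-\<^sup>1 X\<^sub>j)\<close> and averages over the sample points in the estimated level set.
  The derivatives in \<open>x\<close> fall on \<open>\<kappa>\<close> only, so everything reduces to the convergence of averages of
  \<open>w(X\<^sub>j) g(\<phi>\<^sub>n\<^sup>-\<^sup>1 X\<^sub>j)\<close>, uniformly over uniformly bounded and Lipschitz weights \<open>w\<close> and \<open>g\<close> in the unit ball
  of \<open>W(L)\<close>, and to a positive lower bound for the limiting denominator.

  The level set need not be convex, so \<open>g\<close> is not globally Lipschitz. It is Lipschitz on small balls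
  around points of \<open>{f \<ge> t + \<epsilon>}\<close>, and the band \<open>{\<bar>f - t\<bar> \<le> \<epsilon>}\<close>, which absorbs the error of the level set
  estimate, has small mass because the regular level set \<open>{f = t}\<close> is a null set. On
  \<open>{f \<ge> t + \<epsilon>}\<close> a finite partition into small cells reduces the uniform law of large numbers to the
  almost sure convergence of the frequencies of finitely many cells, which follows from Hoeffding's
  inequality and the Borel--Cantelli lemma.
\<close>

section \<open>Empirical frequencies\<close>

text \<open>Hoeffding's inequality for the indicators bounds the deviation probabilities by a
  geometric sequence in \<open>n\<close>. They are summable, so by Borel-Cantelli deviations of a
  given size almost surely occur only finitely often.\<close>

lemma (in prob_space) AE_empirical_frequency_tendsto:
  fixes X :: "nat \<Rightarrow> 'a \<Rightarrow> 'b"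
  assumes indep: "indep_vars (\<lambda>_. N) X UNIV"
    and ident: "\<And>i. distr M N (X i) = distr M N (X 0)"
    and A: "A \<in> sets N"
  shows "AE \<omega> in M. (\<lambda>n. (\<Sum>j<n. indicator A (X j \<omega>)) / real n) \<longlonglongrightarrow> measure (distr M N (X 0)) A"
proof -
  let ?p = "measure (distr M N (X 0)) A"
  let ?Y = "\<lambda>j \<omega>. indicator A (X j \<omega>) :: real"
  have X[measurable]: "X j \<in> measurable M N" for j
    using indep by (auto simp: indep_vars_def)
  have Y[measurable]: "?Y j \<in> borel_measurable M" for j
    using A by measurable
  have E: "expectation (?Y 0) = ?p"
  proof -
    have "?p = integral\<^sup>L (distr M N (X 0)) (indicator A)"
      using A by simp
    also have "\<dots> = expectation (?Y 0)"
      using A by (subst integral_distr) auto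
    finally show ?thesis ..
  qed
  have ih: "indep_vars (\<lambda>_. borel) ?Y UNIV"
    using indep by (rule indep_vars_compose2) (use A in measurable)
  have dY: "distr M borel (?Y i) = distr M borel (?Y 0)" for i
  proof -
    have "distr M borel (?Y i) = distr (distr M N (X i)) borel (indicator A :: _ \<Rightarrow> real)"
      using A by (subst distr_distr) (auto simp: comp_def)
    also have "\<dots> = distr M borel (?Y 0)"
      unfolding ident[of i] using A by (subst distr_distr) (auto simp: comp_def)
    finally show ?thesis .
  qed
  define B where "B e n = {\<omega> \<in> space M. \<bar>(\<Sum>j<n. ?Y j \<omega>) / n - ?p\<bar> \<ge> e}" for e :: real and n :: nat
  have B_meas[measurable]: "B e n \<in> sets M" for e n
    unfolding B_def by measurable
  have B_le: "prob (B e n) \<le> 2 * exp (- 2 * e\<^sup>2) ^ n" if "e > 0" "n > 0" for e and n :: nat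
  proof -
    interpret H: Hoeffding_ineq_iid M "{..<n}" ?Y "?Y 0" 0 1 "?p"
    proof unfold_locales
      show "indep_vars (\<lambda>_. borel) ?Y {..<n}"
        using ih by (rule indep_vars_subset) auto
    qed (use dY Y E in \<open>auto simp: indicator_def\<close>)
    have "prob (B e n) \<le> 2 * exp (- 2 * real n * e\<^sup>2)"
      using H.Hoeffding_ineq_abs_ge'[of e] that by (auto simp: B_def)
    also have "exp (- 2 * real n * e\<^sup>2) = exp (- 2 * e\<^sup>2) ^ n"
      by (simp add: exp_of_nat_mult[symmetric] mult_ac)
    finally show ?thesis .
  qed
  \<comment> \<open>The shift to \<open>Suc n\<close> leaves out the average over zero samples,
    which \<open>B_le\<close> does not cover.\<close>
  have ev: "AE \<omega> in M. eventually (\<lambda>n. \<omega> \<in> space M - B e (Suc n)) sequentially" if e: "e > 0" for e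
  proof (rule borel_cantelli_AE1)
    show "summable (\<lambda>n. prob (B e (Suc n)))"
    proof (rule summable_comparison_test[OF exI[of _ 0]], intro allI impI)
      fix n :: nat
      show "norm (prob (B e (Suc n))) \<le> 2 * exp (- 2 * e\<^sup>2) ^ Suc n"
        using B_le[OF e, of "Suc n"] by simp
      have "summable (\<lambda>n. 2 * exp (- 2 * e\<^sup>2) ^ n)"
        using e by (intro summable_mult summable_geometric) auto
      then show "summable (\<lambda>n. 2 * exp (- 2 * e\<^sup>2) ^ Suc n)"
        by (subst summable_Suc_iff)
    qed
  qed (auto simp: emeasure_eq_measure)
  \<comment> \<open>Countably many tolerances suffice, so the exceptional sets have a null
    union.\<close>
  have "AE \<omega> in M. \<forall>m. eventually (\<lambda>n. \<omega> \<in> space M - B (inverse (Suc m)) (Suc n)) sequentially"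
    using ev by (subst AE_all_countable) auto
  then show ?thesis
  proof eventually_elim
    case (elim \<omega>)
    show ?case
    proof (rule LIMSEQ_imp_Suc, rule tendstoI)
      fix e :: real assume "e > 0"
      then obtain m where m: "inverse (Suc m) < e"
        using reals_Archimedean by blast
      have "eventually (\<lambda>n. \<omega> \<in> space M - B (inverse (Suc m)) (Suc n)) sequentially"
        using elim by blast
      then show "\<forall>\<^sub>F n in sequentially. dist ((\<Sum>j<Suc n. ?Y j \<omega>) / real (Suc n)) ?p < e"
      proof eventually_elim
        case (elim n)
        then show ?case
          using m by (auto simp: B_def dist_real_def simp del: sum.lessThan_Suc of_nat_Suc)
      qed
    qed
  qed
qed

section \<open>Regular level sets\<close>

text \<open>Convexity keeps the segment inside \<open>S\<close>, where the one-variable function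
  \<open>f (a + r u)\<close> of \<open>r\<close> has the positive derivative
  \<open>Df z u\<close>.\<close>

lemma strictly_increasing_along_direction:
  fixes f :: "'a::real_normed_vector \<Rightarrow> real"
  assumes der: "\<And>x. (f has_derivative blinfun_apply (Df x)) (at x)"
    and S: "convex S" "a \<in> S" "a + s *\<^sub>R u \<in> S" "0 < s"
    and pos: "\<And>z. z \<in> S \<Longrightarrow> 0 < Df z u"
  shows "f a < f (a + s *\<^sub>R u)"
proof -
  define p where "p = (\<lambda>r. f (a + r *\<^sub>R u))"
  have "p 0 < p s"
  proof (rule DERIV_pos_imp_increasing[OF \<open>0 < s\<close>])
    fix r assume r: "0 \<le> r" "r \<le> s"
    have "a + r *\<^sub>R u = (1 - r / s) *\<^sub>R a + (r / s) *\<^sub>R (a + s *\<^sub>R u)"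
      using S(4) by (simp add: algebra_simps)
    also have "\<dots> \<in> S"
      using S r by (intro convexD) auto
    finally have "0 < Df (a + r *\<^sub>R u) u" by (rule pos)
    moreover have "((\<lambda>r. a + r *\<^sub>R u) has_derivative (\<lambda>s. s *\<^sub>R u)) (at r)"
      by (auto intro!: derivative_eq_intros)
    from has_derivative_compose[OF this der] have "(p has_real_derivative Df (a + r *\<^sub>R u) u) (at r)"
      by (simp add: p_def has_field_derivative_def blinfun.scaleR_right mult_commute_abs)
    ultimately show "\<exists>y. DERIV p r :> y \<and> 0 < y" by blast
  qed
  then show ?thesis by (simp add: p_def)
qed

lemma ball_derivative_positive:
  fixes Df :: "'a::real_normed_vector \<Rightarrow> 'a \<Rightarrow>\<^sub>L real"
  assumes cont: "continuous_on UNIV Df" and pos: "0 < Df x u"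
  obtains r where "0 < r" "\<And>z. z \<in> ball x r \<Longrightarrow> 0 < Df z u"
proof -
  have "open {z. 0 < Df z u}"
    by (intro open_Collect_less continuous_intros cont)
  then obtain r where "0 < r" "ball x r \<subseteq> {z. 0 < Df z u}"
    using pos by (auto elim: openE)
  then show ?thesis by (intro that[of r]) auto
qed

lemma blinfun_positive_direction:
  fixes A :: "'a::real_normed_vector \<Rightarrow>\<^sub>L real"
  assumes "A \<noteq> 0" obtains u where "0 < A u"
proof -
  obtain v where "A v \<noteq> 0" using assms by (metis blinfun_eqI blinfun.zero_left)
  then show ?thesis
    using that[of v] that[of "- v"] by (cases "0 < A v") (auto simp: blinfun.minus_right)
qed

text \<open>For every \<open>N\<close> there are \<open>N\<close> pairwise disjoint translates of
  \<open>E\<close> inside \<open>S\<close>, all of the same measure. Hence \<open>N\<close> times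
  the measure of \<open>E\<close> never exceeds the finite measure of \<open>S\<close>.\<close>

lemma negligible_of_disjoint_translates:
  fixes E :: "'a::euclidean_space set" and u :: 'a
  assumes E: "E \<in> lmeasurable" and S: "S \<in> lmeasurable"
    and \<delta>: "0 < \<delta>"
    and sub: "\<And>s. 0 < s \<Longrightarrow> s \<le> \<delta> \<Longrightarrow> (+) (s *\<^sub>R u) ` E \<subseteq> S"
    and disj: "\<And>s a b. 0 < s \<Longrightarrow> s \<le> \<delta> \<Longrightarrow> a \<in> E \<Longrightarrow> b \<in> E \<Longrightarrow> b \<noteq> a + s *\<^sub>R u"
  shows "negligible E"
proof -
  have le: "real N * measure lebesgue E \<le> measure lebesgue S" for N
  proof (cases "N = 0")
    case False
    \<comment> \<open>The shifts are equally spaced. With \<open>Suc i\<close> in place of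
      \<open>i\<close> they all lie in the half-open interval from 0 (excluded) to \<delta>, and so
      do their pairwise differences, to which \<open>disj\<close> applies.\<close>
    define T where "T i = (+) ((\<delta> * real (Suc i) / real N) *\<^sub>R u) ` E" for i
    have TE: "T i \<in> lmeasurable" "measure lebesgue (T i) = measure lebesgue E" for i
      unfolding T_def using E by (auto intro: measurable_translation simp: measure_translation)
    have dj: "T i \<inter> T j = {}" if "i < j" "j < N" for i j
    proof -
      { fix a b assume ab: "a \<in> E" "b \<in> E"
          "(\<delta> * real (Suc i) / real N) *\<^sub>R u + a = (\<delta> * real (Suc j) / real N) *\<^sub>R u + b"
        define c where "c i = \<delta> * real (Suc i) / real N" for i
        have "c j - c i = \<delta> * (real j - real i) / real N"
          by (simp add: c_def diff_divide_distrib[symmetric] algebra_simps)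
        moreover have "0 < \<delta> * (real j - real i) / real N" "\<delta> * (real j - real i) / real N \<le> \<delta>"
          using that \<delta> mult_left_mono[of "real j" "real N + real i" \<delta>]
          by (simp_all add: field_simps)
        ultimately have "0 < c j - c i" "c j - c i \<le> \<delta>" by simp_all
        moreover have "a = b + (c j - c i) *\<^sub>R u"
          using ab(3) unfolding c_def[symmetric] by (simp add: scaleR_diff_left algebra_simps)
        ultimately have False using disj ab by blast }
      then show ?thesis unfolding T_def by blast
    qed
    have "real N * measure lebesgue E = (\<Sum>i<N. measure lebesgue (T i))"
      by (simp add: TE)
    also have "\<dots> = measure lebesgue (\<Union>i<N. T i)"
    proof (rule measure_UNION'[symmetric])
      show "pairwise (\<lambda>i j. disjnt (T i) (T j)) {..<N}"
        unfolding pairwise_def disjnt_def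
      proof (intro ballI impI)
        fix i j assume "i \<in> {..<N}" "j \<in> {..<N}" "i \<noteq> j"
        then show "T i \<inter> T j = {}"
          using dj[of i j] dj[of j i] by (cases "i < j") auto
      qed
    qed (use TE in auto)
    also have "\<dots> \<le> measure lebesgue S"
    proof (rule measure_mono_fmeasurable)
      have "T i \<subseteq> S" if "i < N" for i
        unfolding T_def
      proof (rule sub)
        have "\<delta> * real (Suc i) \<le> \<delta> * real N"
          using that \<delta> by (intro mult_left_mono) auto
        then show "\<delta> * real (Suc i) / real N \<le> \<delta>"
          using False by (simp add: divide_le_eq)
      qed (use False \<delta> in simp)
      then show "(\<Union>i<N. T i) \<subseteq> S" by blast
      show "(\<Union>i<N. T i) \<in> sets lebesgue" using TE(1) by blast
    qed (rule S)
    finally show ?thesis .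
  qed auto
  have "measure lebesgue E \<le> 0"
  proof (rule ccontr)
    assume "\<not> ?thesis"
    then obtain N where "measure lebesgue S < real N * measure lebesgue E"
      by (metis reals_Archimedean3 not_le)
    with le[of N] show False by simp
  qed
  then show ?thesis
    using E by (simp add: negligible_iff_measure order_antisym)
qed

text \<open>Negligibility is a local property. Near a point of the level, \<open>f\<close> increases
  strictly along a fixed direction \<open>u\<close>, so a small shift along \<open>u\<close> moves a
  piece of the level set off the level set. The disjoint translates then force measure zero.\<close>

lemma negligible_regular_level_set:
  fixes f :: "'a::euclidean_space \<Rightarrow> real" and Df :: "'a \<Rightarrow> 'a \<Rightarrow>\<^sub>L real"
  assumes der: "\<And>x. (f has_derivative blinfun_apply (Df x)) (at x)"
    and cont: "continuous_on UNIV Df"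
    and reg: "\<And>x. f x = t \<Longrightarrow> Df x \<noteq> 0"
  shows "negligible {x. f x = t}"
proof (subst locally_negligible_alt, intro ballI)
  fix x assume "x \<in> {x. f x = t}"
  then obtain u where u: "0 < Df x u"
    using reg blinfun_positive_direction by blast
  then have "u \<noteq> 0" by auto
  obtain r where r: "0 < r" "\<And>z. z \<in> ball x r \<Longrightarrow> 0 < Df z u"
    using ball_derivative_positive[OF cont u] by blast
  have cf: "continuous_on UNIV f"
    using der by (meson continuous_at_imp_continuous_on has_derivative_continuous)
  \<comment> \<open>Points within \<open>r / 3\<close> of \<open>x\<close>, shifted by at most
    \<open>r / 3\<close>, stay in \<open>ball x r\<close>, where the derivative along
    \<open>u\<close> is positive.\<close>
  let ?E = "{x. f x = t} \<inter> cball x (r / 3)"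
  have "negligible ?E"
  proof (rule negligible_of_disjoint_translates)
    have "closed {x. f x = t}"
      by (intro closed_Collect_eq continuous_intros cf)
    then show "?E \<in> lmeasurable"
      by (intro lmeasurable_compact closed_Int_compact) auto
    show "ball x r \<in> lmeasurable" by simp
    show "0 < r / (3 * norm u)" using r \<open>u \<noteq> 0\<close> by simp
  next
    fix s assume s: "0 < s" "s \<le> r / (3 * norm u)"
    have su: "norm (s *\<^sub>R u) \<le> r / 3"
      using s \<open>u \<noteq> 0\<close> by (simp add: field_simps)
    have shift: "a + s *\<^sub>R u \<in> ball x r" if "a \<in> cball x (r / 3)" for a
    proof -
      have "dist x (a + s *\<^sub>R u) \<le> dist x a + norm (s *\<^sub>R u)"
        using norm_triangle_ineq4[of "x - a" "s *\<^sub>R u"] by (simp add: dist_norm algebra_simps)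
      then show ?thesis using su that r(1) by simp
    qed
    then show "(+) (s *\<^sub>R u) ` ?E \<subseteq> ball x r"
      by (auto simp del: mem_cball mem_ball simp: add.commute)
    fix a b assume ab: "a \<in> ?E" "b \<in> ?E"
    have "f a < f (a + s *\<^sub>R u)"
      by (rule strictly_increasing_along_direction[OF der, of "ball x r"])
         (use r shift ab s in auto)
    then show "b \<noteq> a + s *\<^sub>R u" using ab by auto
  qed
  \<comment> \<open>The closed ball served to make the piece compact, hence measurable; the open
    ball gives the relatively open neighbourhood required by the local criterion.\<close>
  then have "negligible ({x. f x = t} \<inter> ball x (r / 3))"
    by (rule negligible_subset) auto
  moreover have "openin (top_of_set {x. f x = t}) ({x. f x = t} \<inter> ball x (r / 3))"
    by (intro openin_open_Int) auto
  ultimately show "\<exists>U. openin (top_of_set {x. f x = t}) U \<and> x \<in> U \<and> negligible U"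
    using \<open>x \<in> _\<close> r(1) by (intro exI[of _ "{x. f x = t} \<inter> ball x (r / 3)"]) auto
qed

text \<open>Derivatives within a general set need not be unique. Here the set contains a short
  segment from \<open>x\<close> in every direction if \<open>t < f x\<close>, and in every direction
  \<open>v\<close> with \<open>A v > 0\<close> if \<open>f x = t\<close>. Such directions form a
  nonempty open set, and a linear map is determined by its values there.\<close>

lemma has_derivative_unique_superlevel:
  fixes f :: "'a::real_normed_vector \<Rightarrow> real" and F :: "'a \<Rightarrow> 'b::real_normed_vector"
  assumes der: "(f has_derivative blinfun_apply A) (at x)"
    and x: "t \<le> f x" and reg: "f x = t \<Longrightarrow> A \<noteq> 0"
    and F1: "(F has_derivative F1) (at x within {y. t \<le> f y})"
    and F2: "(F has_derivative F2) (at x within {y. t \<le> f y})"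
  shows "F1 = F2"
proof -
  have lin: "linear F1" "linear F2"
    using F1 F2 by (auto dest: has_derivative_bounded_linear bounded_linear.linear)
  have ray: "F1 v = F2 v" if v: "t < f x \<or> 0 < A v" for v
  proof -
    define p where "p = (\<lambda>s. f (x + s *\<^sub>R v))"
    have lv: "((\<lambda>s. x + s *\<^sub>R v) has_derivative (\<lambda>s. s *\<^sub>R v)) (at 0 within T)" for T
      by (auto intro!: derivative_eq_intros)
    have "(p has_derivative (\<lambda>s. A (s *\<^sub>R v))) (at 0)"
      unfolding p_def by (rule has_derivative_compose[OF lv]) (simp add: der)
    then have pd: "(p has_real_derivative A v) (at 0)"
      by (simp add: has_field_derivative_def blinfun.scaleR_right mult_commute_abs)
    \<comment> \<open>The segment stays in the superlevel set by continuity if \<open>f x\<close>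
      exceeds \<open>t\<close>, and by the positive slope \<open>A v\<close> if
      \<open>f x = t\<close>.\<close>
    have "\<exists>d>0. \<forall>s\<in>{0..d}. t \<le> p s"
    proof (cases "t < f x")
      case True
      have "isCont p 0" using pd by (rule DERIV_isCont)
      then obtain d where d: "d > 0" "\<And>s. \<bar>s\<bar> < d \<Longrightarrow> \<bar>p s - p 0\<bar> < f x - t"
        using True unfolding continuous_at_eps_delta dist_real_def
        by (metis diff_gt_0_iff_gt diff_zero)
      have "t \<le> p s" if "s \<in> {0..d / 2}" for s
        using d(2)[of s] d(1) that by (auto simp: p_def)
      with d(1) show ?thesis by (intro exI[of _ "d / 2"]) auto
    next
      case False
      then have "f x = t" "0 < A v" using x v by auto
      then obtain d where d: "d > 0" "\<And>s. s > 0 \<Longrightarrow> s < d \<Longrightarrow> p 0 < p (0 + s)"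
        using DERIV_pos_inc_right[OF pd] by auto
      show ?thesis
        by (rule exI[of _ "d / 2"])
           (use d \<open>f x = t\<close> in \<open>force simp: p_def order_le_less\<close>)
    qed
    then obtain d where d: "d > 0" "\<And>s. s \<in> {0..d} \<Longrightarrow> t \<le> p s" by blast
    have comp: "((\<lambda>s. F (x + s *\<^sub>R v)) has_vector_derivative G v) (at 0 within cbox 0 d)"
      if G: "(F has_derivative G) (at x within {y. t \<le> f y})" for G
    proof -
      have "((\<lambda>s. F (x + s *\<^sub>R v)) has_derivative (\<lambda>s. G (s *\<^sub>R v))) (at 0 within {0..d})"
        by (rule has_derivative_in_compose[OF lv])
           (use d in \<open>auto simp: p_def intro!: has_derivative_subset[OF G]\<close>)
      moreover have "linear G"
        using G by (auto dest: has_derivative_bounded_linear bounded_linear.linear)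
      ultimately show ?thesis
        by (simp add: has_vector_derivative_def linear_scale)
    qed
    show ?thesis
      by (rule vector_derivative_unique_within_closed_interval[OF _ _ comp[OF F1] comp[OF F2]])
         (use d in auto)
  qed
  show ?thesis
  proof (cases "t < f x")
    case True
    then show ?thesis using ray by blast
  next
    case False
    then have "A \<noteq> 0" using x reg by auto
    then obtain u where u: "0 < A u" by (rule blinfun_positive_direction)
    show ?thesis
    proof
      fix v
      \<comment> \<open>Chosen so small that \<open>u + s v\<close> remains in the half-space where
        \<open>A\<close> is positive; the summand 1 keeps the denominator nonzero. By linearity the
        values at \<open>u\<close> and \<open>u + s v\<close> determine the value at
        \<open>v\<close>.\<close>
      define s where "s = A u / (2 * (\<bar>A v\<bar> + 1))"
      have s: "s > 0" using u by (simp add: s_def add_nonneg_pos)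
      have "s * \<bar>A v\<bar> \<le> s * (\<bar>A v\<bar> + 1)" using s by simp
      also have "\<dots> = A u / 2"
        by (simp add: s_def divide_simps)
      finally have "s * \<bar>A v\<bar> < A u" using u by simp
      then have "0 < A u + s * A v"
        using s abs_ge_minus_self[of "s * A v"] by (simp add: abs_mult)
      then have "0 < A (u + s *\<^sub>R v)" by (simp add: blinfun.add_right blinfun.scaleR_right)
      then have "F1 (u + s *\<^sub>R v) = F2 (u + s *\<^sub>R v)" "F1 u = F2 u"
        using ray u by blast+
      then show "F1 v = F2 v"
        using s lin by (simp add: linear_add linear_scale)
    qed
  qed
qed

section \<open>Uniform convergence of empirical averages\<close>

text \<open>A finite cover of \<open>K\<close> by balls of radius \<delta>/2 is intersected with
  \<open>K\<close> and made disjoint by removing from each piece the earlier ones. Some cells may be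
  empty.\<close>

lemma compact_finite_borel_partition:
  fixes K :: "'a::metric_space set"
  assumes K: "compact K" and \<delta>: "0 < \<delta>"
  obtains \<P> where "finite \<P>" "disjoint \<P>" "\<Union>\<P> = K"
    "\<And>A. A \<in> \<P> \<Longrightarrow> A \<in> sets borel"
    "\<And>A a b. A \<in> \<P> \<Longrightarrow> a \<in> A \<Longrightarrow> b \<in> A \<Longrightarrow> dist a b < \<delta>"
proof -
  have "K \<subseteq> (\<Union>c\<in>K. ball c (\<delta> / 2))" using \<delta> by force
  then obtain C where C: "finite C" "K \<subseteq> (\<Union>c\<in>C. ball c (\<delta> / 2))"
    by (rule compactE_image[OF K, of K "\<lambda>c. ball c (\<delta> / 2)", rotated]) auto
  obtain cs where cs: "set cs = C" using C(1) finite_list by blast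
  define N where "N = length cs"
  \<comment> \<open>Padding with empty sets turns the finite cover into a sequence, to which
    \<open>disjointed\<close> applies.\<close>
  define B where "B i = (if i < N then K \<inter> ball (cs ! i) (\<delta> / 2) else {})" for i
  have UB: "(\<Union>i<N. B i) = K"
  proof
    show "K \<subseteq> (\<Union>i<N. B i)"
    proof
      fix y assume y: "y \<in> K"
      then obtain c where "c \<in> set cs" "y \<in> ball c (\<delta> / 2)" using C(2) cs by blast
      then obtain i where "i < N" "y \<in> ball (cs ! i) (\<delta> / 2)"
        by (auto simp: N_def in_set_conv_nth)
      then show "y \<in> (\<Union>i<N. B i)" using y by (auto simp: B_def)
    qed
  qed (auto simp: B_def)
  define D where "D = disjointed B"
  have DB: "D i \<subseteq> B i" for i unfolding D_def by (rule disjointed_subset)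
  have "disjoint_family D" unfolding D_def by (rule disjoint_family_disjointed)
  show ?thesis
  proof (rule that[of "D ` {..<N}"])
    show "disjoint (D ` {..<N})"
      using disjoint_family_on_mono[OF subset_UNIV \<open>disjoint_family D\<close>]
      by (rule disjoint_family_on_disjoint_image)
    have "\<Union>(D ` {..<N}) = (\<Union>i\<in>{0..<N}. D i)" by (simp add: lessThan_atLeast0)
    also have "\<dots> = (\<Union>i\<in>{0..<N}. B i)"
      unfolding D_def by (rule finite_UN_disjointed_eq)
    also have "\<dots> = K" using UB by (simp add: lessThan_atLeast0)
    finally show "\<Union>(D ` {..<N}) = K" .
    have "B i \<in> sets borel" for i
      using K by (auto simp: B_def compact_imp_closed)
    then have "D i \<in> sets borel" for i
      unfolding D_def disjointed_def by auto
    then show "A \<in> sets borel" if "A \<in> D ` {..<N}" for A using that by blast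
    fix A a b assume "A \<in> D ` {..<N}" "a \<in> A" "b \<in> A"
    then obtain i where "i < N" "a \<in> B i" "b \<in> B i" using DB by blast
    then have "dist (cs ! i) a < \<delta> / 2" "dist (cs ! i) b < \<delta> / 2" by (auto simp: B_def)
    then show "dist a b < \<delta>" by (metis dist_triangle_half_r)
  qed auto
qed

text \<open>Only the frequencies of the cells of a finite partition enter, so the estimate is uniform
  over all functions with the same oscillation on the cells.\<close>
lemma empirical_mean_integral_bound:
  fixes F :: "'a::euclidean_space \<Rightarrow> complex" and \<xi> :: "nat \<Rightarrow> 'a"
  assumes \<mu>: "prob_space \<mu>" and fin: "finite \<P>" and dj: "disjoint \<P>"
    and meas: "\<And>A. A \<in> \<P> \<Longrightarrow> A \<in> sets \<mu>"
    and int: "set_integrable \<mu> (\<Union>\<P>) F"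
    and bdd: "\<And>y. y \<in> \<Union>\<P> \<Longrightarrow> cmod (F y) \<le> C"
    and osc: "\<And>A a b. A \<in> \<P> \<Longrightarrow> a \<in> A \<Longrightarrow> b \<in> A \<Longrightarrow> cmod (F a - F b) \<le> \<eta>"
    and \<eta>: "0 \<le> \<eta>" and n: "0 < n"
  shows "cmod ((\<Sum>j<n. indicator (\<Union>\<P>) (\<xi> j) *\<^sub>R F (\<xi> j)) /\<^sub>R real n - (LINT y:\<Union>\<P>|\<mu>. F y))
         \<le> 2 * \<eta> + C * (\<Sum>A\<in>\<P>. \<bar>(\<Sum>j<n. indicator A (\<xi> j)) / real n - measure \<mu> A\<bar>)"
proof -
  interpret prob_space \<mu> by fact
  define fr where "fr A = (\<Sum>j<n. indicator A (\<xi> j)) / real n" for A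
  \<comment> \<open>The value of \<open>F\<close> at an arbitrary point of the cell, with default 0
    for an empty cell.\<close>
  define c where "c A = (if A = {} then 0 else F (SOME a. a \<in> A))" for A
  have some: "(SOME a. a \<in> A) \<in> A" if "A \<noteq> {}" for A :: "'a set"
    using that by (auto intro: someI_ex)
  have c_osc: "cmod (F a - c A) \<le> \<eta>" if "A \<in> \<P>" "a \<in> A" for A a
    using that osc some by (auto simp: c_def)
  \<comment> \<open>An empty cell gives no information on the sign of \<open>C\<close>. Its
    frequency and its measure both vanish, whence the side condition on \<open>r\<close>.\<close>
  have c_bdd: "\<bar>r\<bar> * cmod (c A) \<le> C * \<bar>r\<bar>" if "A \<in> \<P>" "A = {} \<Longrightarrow> r = 0" for A and r :: real
    using that bdd[of "SOME a. a \<in> A"] some[of A]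
    by (auto simp: c_def mult.commute[of C] intro!: mult_left_mono)
  define G where "G y = (\<Sum>A\<in>\<P>. indicator A y *\<^sub>R c A)" for y
  have G: "G y = c A" if "A \<in> \<P>" "y \<in> A" for A y
  proof -
    have "indicator B y *\<^sub>R c B = (if B = A then c A else 0)" if "B \<in> \<P>" for B
      using that \<open>A \<in> \<P>\<close> \<open>y \<in> A\<close> dj by (auto simp: disjoint_def indicator_def)
    then show ?thesis
      using fin \<open>A \<in> \<P>\<close> by (simp add: G_def cong: sum.cong)
  qed
  have G0: "G y = 0" if "y \<notin> \<Union>\<P>" for y
    using that by (auto simp: G_def intro!: sum.neutral)
  have FG: "cmod (indicator (\<Union>\<P>) y *\<^sub>R F y - G y) \<le> \<eta>" for y
    using c_osc G G0 \<eta> by (cases "y \<in> \<Union>\<P>") auto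
  have "has_bochner_integral \<mu> G (\<Sum>A\<in>\<P>. measure \<mu> A *\<^sub>R c A)"
    unfolding G_def using meas
    by (intro has_bochner_integral_sum has_bochner_integral_indicator) (auto simp: emeasure_eq_measure)
  then have intG: "integrable \<mu> G" and LG: "integral\<^sup>L \<mu> G = (\<Sum>A\<in>\<P>. measure \<mu> A *\<^sub>R c A)"
    by (auto simp: has_bochner_integral_iff)
  have SG: "(\<Sum>j<n. G (\<xi> j)) /\<^sub>R real n = (\<Sum>A\<in>\<P>. fr A *\<^sub>R c A)"
    unfolding G_def fr_def
    by (subst sum.swap)
       (simp add: scaleR_sum_right scaleR_sum_left[symmetric] divide_inverse mult.commute)
  let ?I = "(\<Sum>j<n. indicator (\<Union>\<P>) (\<xi> j) *\<^sub>R F (\<xi> j)) /\<^sub>R real n"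
  have 1: "cmod (?I - (\<Sum>j<n. G (\<xi> j)) /\<^sub>R real n) \<le> \<eta>"
  proof -
    define H where "H j = indicator (\<Union>\<P>) (\<xi> j) *\<^sub>R F (\<xi> j)" for j
    have "cmod (\<Sum>j<n. H j - G (\<xi> j)) \<le> (\<Sum>j<n. \<eta>)"
      unfolding H_def by (intro sum_norm_le FG)
    then have "cmod ((\<Sum>j<n. H j - G (\<xi> j)) /\<^sub>R real n) \<le> \<eta>"
      using n by (simp add: divide_simps mult.commute)
    then show ?thesis
      by (simp add: sum_subtractf scaleR_diff_right flip: H_def)
  qed
  have 2: "cmod (integral\<^sup>L \<mu> G - (LINT y:\<Union>\<P>|\<mu>. F y)) \<le> \<eta>"
  proof -
    have "integral\<^sup>L \<mu> G - (LINT y:\<Union>\<P>|\<mu>. F y) = (LINT y|\<mu>. G y - indicator (\<Union>\<P>) y *\<^sub>R F y)"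
      using int intG unfolding set_lebesgue_integral_def set_integrable_def by simp
    also have "cmod \<dots> \<le> (LINT y|\<mu>. \<eta>)"
    proof (rule Bochner_Integration.integral_norm_bound_integral)
      show "integrable \<mu> (\<lambda>y. G y - indicator (\<Union>\<P>) y *\<^sub>R F y)"
        using int intG unfolding set_integrable_def by simp
      show "cmod (G y - indicator (\<Union>\<P>) y *\<^sub>R F y) \<le> \<eta>" for y
        using FG[of y] by (simp add: norm_minus_commute)
    qed simp
    finally show ?thesis by (simp add: prob_space)
  qed
  have 3: "cmod ((\<Sum>A\<in>\<P>. fr A *\<^sub>R c A) - (\<Sum>A\<in>\<P>. measure \<mu> A *\<^sub>R c A))
      \<le> C * (\<Sum>A\<in>\<P>. \<bar>fr A - measure \<mu> A\<bar>)"
    unfolding sum_subtractf[symmetric] sum_distrib_left scaleR_diff_left[symmetric]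
    by (intro sum_norm_le) (auto intro!: c_bdd simp: fr_def)
  \<comment> \<open>Three errors: replacing \<open>F\<close> by the step function \<open>G\<close>
    in the empirical mean, replacing frequencies by measures, and returning from \<open>G\<close> to
    \<open>F\<close> in the integral. The first and the last cost \<eta> each.\<close>
  have "?I - (LINT y:\<Union>\<P>|\<mu>. F y) = (?I - (\<Sum>j<n. G (\<xi> j)) /\<^sub>R real n)
      + ((\<Sum>A\<in>\<P>. fr A *\<^sub>R c A) - (\<Sum>A\<in>\<P>. measure \<mu> A *\<^sub>R c A))
      + (integral\<^sup>L \<mu> G - (LINT y:\<Union>\<P>|\<mu>. F y))"
    by (simp add: SG LG)
  also have "cmod \<dots> \<le> \<eta> + C * (\<Sum>A\<in>\<P>. \<bar>fr A - measure \<mu> A\<bar>) + \<eta>"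
    using 1 2 3 by (intro order_trans[OF norm_triangle_ineq] add_mono) auto
  finally show ?thesis by (simp add: fr_def)
qed

text \<open>Serves as a superset of the unit ball of W(D). Values and derivatives are bounded
  separately and pointwise, and an arbitrary derivative is allowed because derivatives within
  \<open>D\<close> may fail to be unique.\<close>

definition unit_W :: "'a::real_normed_vector set \<Rightarrow> ('a \<Rightarrow> complex) \<Rightarrow> bool" where
  "unit_W D g \<longleftrightarrow> (\<forall>x\<in>D. cmod (g x) \<le> 1 \<and>
     (\<exists>g'. (g has_derivative g') (at x within D) \<and> onorm g' \<le> 1))"

text \<open>Lets the denominators be treated as numerators with the test function 1.\<close>

lemma unit_W_one: "unit_W D (\<lambda>_. 1)"
  by (auto simp: unit_W_def onorm_zero intro!: exI[of _ "\<lambda>_. 0"])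

lemma unit_W_norm: "unit_W D g \<Longrightarrow> x \<in> D \<Longrightarrow> cmod (g x) \<le> 1"
  by (simp add: unit_W_def)

lemma unit_W_continuous_on: "unit_W D g \<Longrightarrow> continuous_on D g"
  unfolding unit_W_def continuous_on_eq_continuous_within by (meson has_derivative_continuous)

text \<open>A ball is convex, so the mean value inequality applies inside it, although
  \<open>D\<close> itself may be far from convex.\<close>

lemma unit_W_lipschitz_ball:
  assumes g: "unit_W D g" and sub: "ball a r \<subseteq> D" and b: "dist a b < r"
  shows "cmod (g a - g b) \<le> dist a b"
proof -
  obtain g' where g': "\<And>x. x \<in> D \<Longrightarrow> (g has_derivative g' x) (at x within D) \<and> onorm (g' x) \<le> 1"
    using g unfolding unit_W_def by metis
  have "cmod (g a - g b) \<le> 1 * norm (a - b)"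
  proof (rule differentiable_bound[of "ball a r" g g'])
    show "a \<in> ball a r" using le_less_trans[OF zero_le_dist b] by simp
    show "b \<in> ball a r" using b by simp
  qed (use g' sub has_derivative_subset in blast)+
  then show ?thesis by (simp add: dist_norm)
qed

text \<open>Boundedness in \<open>inW\<close> makes the two real suprema in \<open>Wnorm\<close>
  genuine upper bounds; the two pointwise norms are nonnegative with sum at most 1, so each is at
  most 1.\<close>

lemma inW_Wnorm_le_1_imp_unit_W:
  fixes D :: "'a::euclidean_space set"
  assumes g: "inW D g" and le: "Wnorm D g \<le> 1"
  shows "unit_W D g"
proof -
  let ?d = "\<lambda>x. Blinfun (frechet_derivative g (at x within D))"
  have b1: "bdd_above ((\<lambda>x. cmod (g x)) ` D)"
    using g unfolding inW_def bounded_iff bdd_above_def by auto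
  have b2: "bdd_above ((\<lambda>x. norm (?d x)) ` D)"
    using g unfolding inW_def bounded_iff bdd_above_def by auto
  show ?thesis
    unfolding unit_W_def
  proof (intro ballI)
    fix x assume x: "x \<in> D"
    have u1: "cmod (g x) \<le> (SUP x\<in>D. cmod (g x))" by (rule cSUP_upper[OF x b1])
    have u2: "norm (?d x) \<le> (SUP x\<in>D. norm (?d x))" by (rule cSUP_upper[OF x b2])
    have "cmod (g x) + norm (?d x) \<le> 1"
      using u1 u2 le unfolding Wnorm_def by linarith
    then have "cmod (g x) \<le> 1" "norm (?d x) \<le> 1"
      using norm_ge_zero[of "g x"] norm_ge_zero[of "?d x"] by linarith+
    moreover have hd: "(g has_derivative frechet_derivative g (at x within D)) (at x within D)"
      using g x unfolding inW_def by (simp add: frechet_derivative_works)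
    ultimately show "cmod (g x) \<le> 1 \<and> (\<exists>g'. (g has_derivative g') (at x within D) \<and> onorm g' \<le> 1)"
      by (auto simp: norm_blinfun.rep_eq bounded_linear_Blinfun_apply has_derivative_bounded_linear)
  qed
qed

text \<open>The bands of half-width \<open>inverse (Suc m)\<close> decrease to the null set where
  \<open>f = t\<close>; continuity from above gives the claim.\<close>

lemma measure_band_small:
  fixes f :: "'a \<Rightarrow> real"
  assumes \<mu>: "finite_measure \<mu>" and f: "f \<in> borel_measurable \<mu>"
    and null: "{x. f x = t} \<in> null_sets \<mu>" and e: "0 < e" and sp: "space \<mu> = UNIV"
  obtains \<epsilon> where "0 < \<epsilon>" "measure \<mu> (band f (t - \<epsilon>) (t + \<epsilon>)) < e"
proof -
  interpret finite_measure \<mu> by fact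
  define B where "B m = band f (t - inverse (Suc m)) (t + inverse (Suc m))" for m
  have B: "B m \<in> sets \<mu>" for m
  proof -
    have "{x \<in> space \<mu>. t - inverse (Suc m) \<le> f x \<and> f x \<le> t + inverse (Suc m)} \<in> sets \<mu>"
      using f by measurable
    then show ?thesis by (simp add: B_def band_def sp)
  qed
  have "decseq B"
  proof (rule decseq_SucI)
    fix m
    have "inverse (real (Suc (Suc m))) \<le> inverse (real (Suc m))" by (intro le_imp_inverse_le) auto
    then have "x \<in> B m" if "x \<in> B (Suc m)" for x
      using that unfolding B_def band_def mem_Collect_eq by linarith
    then show "B (Suc m) \<subseteq> B m" by blast
  qed
  then have "(\<lambda>m. measure \<mu> (B m)) \<longlonglongrightarrow> measure \<mu> (\<Inter>m. B m)"
    using B by (intro finite_Lim_measure_decseq) auto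
  moreover have "(\<Inter>m. B m) = {x. f x = t}"
  proof -
    have "f x = t" if "\<And>m. x \<in> B m" for x
    proof (rule ccontr)
      assume "f x \<noteq> t"
      then obtain m where "inverse (Suc m) < \<bar>f x - t\<bar>"
        using reals_Archimedean[of "\<bar>f x - t\<bar>"] by auto
      then show False using that[of m] by (auto simp: B_def band_def)
    qed
    then show ?thesis by (auto simp: B_def band_def sp)
  qed
  moreover have "measure \<mu> {x. f x = t} = 0"
    using null by (simp add: null_sets_def measure_def)
  ultimately have "(\<lambda>m. measure \<mu> (B m)) \<longlonglongrightarrow> 0" by simp
  then have "eventually (\<lambda>m. measure \<mu> (B m) < e) sequentially"
    using e by (rule order_tendstoD(2))
  then obtain m where "measure \<mu> (B m) < e"
    by (auto dest: eventually_happens)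
  then show ?thesis using that[of "inverse (Suc m)"] by (simp add: B_def)
qed

text \<open>The compact set where \<open>f\<close> is at least \<open>t + \<epsilon>\<close> is
  disjoint from the closed set where \<open>f\<close> is at most \<open>t\<close>, hence at positive
  distance from it.\<close>

lemma lev_thickening_subset:
  fixes f :: "'a::euclidean_space \<Rightarrow> real"
  assumes cf: "continuous_on UNIV f" and L: "compact (lev f t)" and \<epsilon>: "0 < \<epsilon>"
  shows "compact (lev f (t + \<epsilon>))"
    and "\<exists>r>0. \<forall>y\<in>lev f (t + \<epsilon>). ball y r \<subseteq> lev f t"
proof -
  have "closed (lev f (t + \<epsilon>))"
    unfolding lev_def by (intro closed_Collect_le continuous_intros cf)
  moreover have "lev f (t + \<epsilon>) = lev f t \<inter> lev f (t + \<epsilon>)"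
    using \<epsilon> by (auto simp: lev_def)
  ultimately show c: "compact (lev f (t + \<epsilon>))"
    using compact_Int_closed[OF L] by metis
  have "closed {x. f x \<le> t}" by (intro closed_Collect_le continuous_intros cf)
  then obtain r where r: "r > 0" "\<And>x y. x \<in> lev f (t + \<epsilon>) \<Longrightarrow> f y \<le> t \<Longrightarrow> r \<le> dist x y"
    using separate_compact_closed[OF c, of "{x. f x \<le> t}"] \<epsilon> by (fastforce simp: lev_def)
  have "ball y r \<subseteq> lev f t" if "y \<in> lev f (t + \<epsilon>)" for y
  proof
    fix z assume "z \<in> ball y r"
    then show "z \<in> lev f t" using r(2)[OF that, of z] by (cases "f z \<le> t") (auto simp: lev_def)
  qed
  then show "\<exists>r>0. \<forall>y\<in>lev f (t + \<epsilon>). ball y r \<subseteq> lev f t" using r(1) by blast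
qed

text \<open>Away from a thin band around the level, membership in the estimated and in the true level set
  agree and test functions are Lipschitz on small balls; the band itself only contributes its mass.\<close>
lemma empirical_level_set_bound:
  fixes f :: "'a::euclidean_space \<Rightarrow> real" and \<xi> :: "nat \<Rightarrow> 'a" and w :: "'a \<Rightarrow> real"
  assumes \<mu>: "prob_space \<mu>" and sets: "sets \<mu> = sets borel"
    and cf: "continuous_on UNIV f" and \<epsilon>: "0 < \<epsilon>" and \<delta>: "0 \<le> \<delta>" and n: "0 < n"
    and ball: "\<And>y. y \<in> lev f (t + \<epsilon>) \<Longrightarrow> ball y \<delta> \<subseteq> lev f t"
    and part: "finite \<P>" "disjoint \<P>" "\<Union>\<P> = lev f (t + \<epsilon>)"
      "\<And>A. A \<in> \<P> \<Longrightarrow> A \<in> sets borel"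
      "\<And>A a b. A \<in> \<P> \<Longrightarrow> a \<in> A \<Longrightarrow> b \<in> A \<Longrightarrow> dist a b < \<delta>"
    and J: "J \<subseteq> {..<n}" "\<And>j. j \<in> J \<Longrightarrow> t - \<epsilon> \<le> f (\<xi> j)"
      "\<And>j. j < n \<Longrightarrow> t + \<epsilon> \<le> f (\<xi> j) \<Longrightarrow> j \<in> J"
    and \<psi>: "\<And>j. j \<in> J \<Longrightarrow> \<psi> (\<xi> j) \<in> lev f t" "\<And>j. j \<in> J \<Longrightarrow> dist (\<xi> j) (\<psi> (\<xi> j)) < \<delta>"
    and w: "\<And>y. \<bar>w y\<bar> \<le> C" "\<And>y z. \<bar>w y - w z\<bar> \<le> C * norm (y - z)"
    and g: "unit_W (lev f t) g"
  shows "cmod ((\<Sum>j\<in>J. complex_of_real (w (\<xi> j)) * g (\<psi> (\<xi> j))) /\<^sub>R real n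
            - (LINT y:lev f t|\<mu>. complex_of_real (w y) * g y))
         \<le> C * (5 * \<delta> + (\<Sum>j<n. indicator (band f (t - \<epsilon>) (t + \<epsilon>)) (\<xi> j)) / real n
               + (\<Sum>A\<in>\<P>. \<bar>(\<Sum>j<n. indicator A (\<xi> j)) / real n - measure \<mu> A\<bar>)
               + measure \<mu> (band f (t - \<epsilon>) (t + \<epsilon>)))"
proof -
  interpret prob_space \<mu> by fact
  have C: "0 \<le> C" using w(1)[of 0] by linarith
  let ?B = "band f (t - \<epsilon>) (t + \<epsilon>)"
  let ?L = "lev f t" and ?L' = "lev f (t + \<epsilon>)"
  define F where "F y = complex_of_real (w y) * g y" for y
  have L'L: "?L' \<subseteq> ?L" using \<epsilon> by (auto simp: lev_def)
  have glip: "cmod (g a - g b) \<le> \<delta>" if "a \<in> ?L'" "dist a b < \<delta>" for a b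
    using unit_W_lipschitz_ball[OF g ball that(2)] that by simp
  have F_le: "cmod (F y) \<le> C" if "y \<in> ?L" for y
  proof -
    have "cmod (F y) \<le> C * 1"
      unfolding F_def norm_mult using w(1) unit_W_norm[OF g that] C by (intro mult_mono) auto
    then show ?thesis by simp
  qed
  have cw: "continuous_on UNIV w"
  proof (rule lipschitz_on_continuous_on[of C], rule lipschitz_onI)
    show "dist (w x) (w y) \<le> C * dist x y" for x y
      using w(2) by (simp add: dist_norm)
  qed (rule C)
  have sL: "?L \<in> sets \<mu>" "?L' \<in> sets \<mu>" "?B \<in> sets \<mu>"
    unfolding sets lev_def band_def
    by (intro borel_closed closed_Collect_le closed_Collect_conj continuous_intros cf)+
  have iL: "set_integrable \<mu> ?L F"
    unfolding set_integrable_def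
  proof (rule integrable_const_bound[of _ C])
    have "continuous_on ?L F"
      unfolding F_def by (intro continuous_intros unit_W_continuous_on[OF g] continuous_on_subset[OF cw]) auto
    then have "(\<lambda>x. indicator ?L x *\<^sub>R F x) \<in> borel_measurable borel"
      using sL by (intro borel_measurable_continuous_on_indicator) (auto simp: sets)
    then show "(\<lambda>x. indicator ?L x *\<^sub>R F x) \<in> borel_measurable \<mu>"
      by (subst measurable_cong_sets[OF sets refl])
    show "AE x in \<mu>. cmod (indicator ?L x *\<^sub>R F x) \<le> C"
      using F_le C by (auto simp: indicator_def)
  qed
  have iL': "set_integrable \<mu> ?L' F"
    using iL sL(2) L'L by (rule set_integrable_subset)
  let ?E = "(\<Sum>j<n. indicator ?L' (\<xi> j) *\<^sub>R F (\<xi> j)) /\<^sub>R real n"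
  let ?S = "\<Sum>j\<in>J. complex_of_real (w (\<xi> j)) * g (\<psi> (\<xi> j))"
  have 1: "cmod (?S /\<^sub>R real n - ?E) \<le> C * \<delta> + C * ((\<Sum>j<n. indicator ?B (\<xi> j)) / real n)"
  proof -
    \<comment> \<open>Extension by zero from \<open>J\<close> to all indices below \<open>n\<close>,
      so that both sums can be compared term by term.\<close>
    define T where "T j = (if j \<in> J then complex_of_real (w (\<xi> j)) * g (\<psi> (\<xi> j)) else 0)" for j
    have ST: "?S = (\<Sum>j<n. T j)"
      unfolding T_def using J(1) by (simp add: sum.If_cases Int_absorb1)
    \<comment> \<open>A sample in \<open>?L'\<close> is counted by both sums and only the
      displacement by \<psi> matters. A sample of \<open>J\<close> outside \<open>?L'\<close> lies
      in the band and costs at most \<open>C\<close>. All other terms vanish.\<close>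
    have summand: "cmod (T j - indicator ?L' (\<xi> j) *\<^sub>R F (\<xi> j)) \<le> C * \<delta> + C * indicator ?B (\<xi> j)"
      if j: "j < n" for j
    proof (cases "\<xi> j \<in> ?L'")
      case True
      then have jJ: "j \<in> J" using J(3)[OF j] by (simp add: lev_def)
      have "cmod (T j - indicator ?L' (\<xi> j) *\<^sub>R F (\<xi> j)) = \<bar>w (\<xi> j)\<bar> * cmod (g (\<xi> j) - g (\<psi> (\<xi> j)))"
        using True jJ
        by (simp add: T_def F_def right_diff_distrib[symmetric] norm_mult norm_minus_commute)
      also have "\<dots> \<le> C * \<delta>"
        using w(1) glip[OF True \<psi>(2)[OF jJ]] C by (intro mult_mono) auto
      finally show ?thesis using C by (simp add: indicator_def)
    next
      case False
      show ?thesis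
      proof (cases "j \<in> J")
        case True
        have "\<xi> j \<in> ?B" using False J(2)[OF True] by (simp add: band_def lev_def)
        moreover have "cmod (T j) \<le> C * 1"
          unfolding T_def if_P[OF True] norm_mult
          using w(1) unit_W_norm[OF g \<psi>(1)[OF True]] C by (intro mult_mono) auto
        ultimately show ?thesis using False mult_nonneg_nonneg[OF C \<delta>] by simp
      next
        case False
        then show ?thesis using \<open>\<xi> j \<notin> ?L'\<close> \<delta> C by (simp add: T_def)
      qed
    qed
    have "?S /\<^sub>R real n - ?E = (\<Sum>j<n. T j - indicator ?L' (\<xi> j) *\<^sub>R F (\<xi> j)) /\<^sub>R real n"
      unfolding ST sum_subtractf scaleR_diff_right ..
    also have "cmod \<dots> \<le> (\<Sum>j<n. C * \<delta> + C * indicator ?B (\<xi> j)) / real n"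
    proof -
      have "cmod (\<Sum>j<n. T j - indicator ?L' (\<xi> j) *\<^sub>R F (\<xi> j)) \<le> (\<Sum>j<n. C * \<delta> + C * indicator ?B (\<xi> j))"
        by (rule sum_norm_le) (rule summand, simp)
      then show ?thesis
        unfolding norm_scaleR by (simp add: divide_inverse_commute mult_left_mono)
    qed
    also have "\<dots> = C * \<delta> + C * ((\<Sum>j<n. indicator ?B (\<xi> j)) / real n)"
      using n by (simp add: sum.distrib add_divide_distrib sum_distrib_left[symmetric] del: sum_mult_indicator)
    finally show ?thesis .
  qed
  have 2: "cmod (?E - (LINT y:?L'|\<mu>. F y))
      \<le> 2 * (2 * C * \<delta>) + C * (\<Sum>A\<in>\<P>. \<bar>(\<Sum>j<n. indicator A (\<xi> j)) / real n - measure \<mu> A\<bar>)"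
    unfolding part(3)[symmetric]
  proof (rule empirical_mean_integral_bound)
    \<comment> \<open>One \<open>C * \<delta>\<close> comes from the Lipschitz weight, the other
      from the test function, which is Lipschitz on the small ball around \<open>a\<close>.\<close>
    show "cmod (F a - F b) \<le> 2 * C * \<delta>" if A: "A \<in> \<P>" "a \<in> A" "b \<in> A" for A a b
    proof -
      have aL: "a \<in> ?L'" using A part(3) by blast
      have d: "dist a b < \<delta>" using part(5)[OF A] .
      have "F a - F b = complex_of_real (w a - w b) * g a + complex_of_real (w b) * (g a - g b)"
        by (simp add: F_def algebra_simps)
      also have "cmod \<dots> \<le> \<bar>w a - w b\<bar> * cmod (g a) + \<bar>w b\<bar> * cmod (g a - g b)"
        by (rule order_trans[OF norm_triangle_ineq]) (simp add: norm_mult del: of_real_diff)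
      also have "\<dots> \<le> (C * \<delta>) * 1 + C * \<delta>"
      proof (intro add_mono mult_mono)
        show "\<bar>w a - w b\<bar> \<le> C * \<delta>"
          using w(2)[of a b] mult_left_mono[OF less_imp_le[OF d] C] by (simp add: dist_norm)
      qed (use C \<delta> w(1) glip[OF aL d] unit_W_norm[OF g] L'L aL in auto)
      finally show ?thesis by simp
    qed
  qed (use \<mu> part sets iL' F_le L'L C \<delta> n in auto)
  \<comment> \<open>The two indicators differ only where \<open>f\<close> lies between
    \<open>t\<close> and \<open>t + \<epsilon>\<close>, hence inside the band.\<close>
  have 3: "cmod ((LINT y:?L'|\<mu>. F y) - (LINT y:?L|\<mu>. F y)) \<le> C * measure \<mu> ?B"
  proof -
    have "(LINT y:?L'|\<mu>. F y) - (LINT y:?L|\<mu>. F y)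
        = (LINT y|\<mu>. indicator ?L' y *\<^sub>R F y - indicator ?L y *\<^sub>R F y)"
      using iL iL' unfolding set_lebesgue_integral_def set_integrable_def by simp
    also have "cmod \<dots> \<le> (LINT y|\<mu>. C * indicator ?B y)"
    proof (rule Bochner_Integration.integral_norm_bound_integral)
      show "integrable \<mu> (\<lambda>y. indicator ?L' y *\<^sub>R F y - indicator ?L y *\<^sub>R F y)"
        using iL iL' unfolding set_integrable_def by simp
      show "integrable \<mu> (\<lambda>y. C * indicator ?B y)"
        using sL by (auto simp: emeasure_eq_measure)
      show "cmod (indicator ?L' y *\<^sub>R F y - indicator ?L y *\<^sub>R F y) \<le> C * indicator ?B y" for y
        using F_le[of y] \<epsilon> C by (auto simp: indicator_def lev_def band_def)
    qed
    also have "\<dots> = C * measure \<mu> ?B" using sL by simp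
    finally show ?thesis .
  qed
  \<comment> \<open>The 5 is one \<delta> for the displacement by \<psi> and four for the
    oscillation on cells, which enters once in the mean and once in the integral.\<close>
  have collect: "(C * \<delta> + C * a) + (2 * (2 * C * \<delta>) + C * b) + C * c = C * (5 * \<delta> + a + b + c)" for a b c
    by (simp add: algebra_simps)
  have tri: "cmod (p - s) \<le> a + b + c" if "cmod (p - q) \<le> a" "cmod (q - r) \<le> b" "cmod (r - s) \<le> c"
    for p q r s :: complex and a b c
    using that norm_triangle_ineq[of "p - q" "q - r"] norm_triangle_ineq[of "p - r" "r - s"] by simp
  show ?thesis
    using tri[OF 1 2 3] unfolding collect F_def .
qed

text \<open>The band and the partition are fixed before \<open>w\<close> and \<open>g\<close> are
  chosen. Almost sure convergence is invoked only for finitely many cells and the band; for large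
  \<open>n\<close> the deterministic estimate then covers all \<open>w\<close> and \<open>g\<close>
  at once.\<close>

lemma (in prob_space) AE_uniform_empirical_bound:
  fixes X :: "nat \<Rightarrow> 'a \<Rightarrow> 'b::euclidean_space" and f :: "'b \<Rightarrow> real"
  defines "\<mu> \<equiv> distr M lborel (X 0)"
  assumes indep: "indep_vars (\<lambda>_. lborel) X UNIV"
    and ident: "\<And>i. distr M lborel (X i) = \<mu>"
    and cf: "continuous_on UNIV f" and L: "compact (lev f t)"
    and null: "{x. f x = t} \<in> null_sets \<mu>"
    and eps: "eps \<longlonglongrightarrow> 0"
    and bij: "\<And>n. bij (phi n)" and phi_L: "\<And>n. phi n ` lev f t = lev f (t - eps n)"
    and phi_id: "\<And>\<delta>. 0 < \<delta> \<Longrightarrow> eventually (\<lambda>n. \<forall>x\<in>lev f t. norm (phi n x - x) < \<delta>) sequentially"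
    and close: "AE \<omega> in M. eventually (\<lambda>n. \<forall>x. \<bar>fhat n (sample X n \<omega>) x - f x\<bar> \<le> eps n) sequentially"
    and C: "0 \<le> C" and \<eta>: "0 < \<eta>"
  shows "AE \<omega> in M. eventually (\<lambda>n. \<forall>w g.
      (\<forall>y. \<bar>w y\<bar> \<le> C) \<longrightarrow> (\<forall>y z. \<bar>w y - w z\<bar> \<le> C * norm (y - z)) \<longrightarrow> unit_W (lev f t) g \<longrightarrow>
      cmod ((\<Sum>j\<in>Jn fhat X t n \<omega>. complex_of_real (w (X j \<omega>)) * g (inv (phi n) (X j \<omega>))) /\<^sub>R real n
         - (LINT y:lev f t|\<mu>. complex_of_real (w y) * g y)) \<le> \<eta>) sequentially"
proof -
  have X0: "X 0 \<in> measurable M lborel"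
    using indep by (auto simp: indep_vars_def)
  have \<mu>: "prob_space \<mu>" unfolding \<mu>_def by (rule prob_space_distr) (rule X0)
  then interpret \<mu>: prob_space \<mu> .
  have sets: "sets \<mu> = sets borel" and sp: "space \<mu> = UNIV" by (simp_all add: \<mu>_def)
  \<comment> \<open>The four error terms will add up to at most \<open>8 * e\<close>, so
    \<open>C * (9 * e)\<close> is a sufficient budget. The summand 1 covers the case
    \<open>C = 0\<close>.\<close>
  define e where "e = \<eta> / (9 * C + 1)"
  have e: "0 < e" using C \<eta> by (simp add: e_def)
  have Ce: "C * (9 * e) \<le> \<eta>"
  proof -
    have "C * (9 * e) \<le> (9 * C + 1) * e" using e by (simp add: algebra_simps)
    also have "\<dots> = \<eta>" using C by (simp add: e_def)
    finally show ?thesis .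
  qed
  obtain \<epsilon> where \<epsilon>: "0 < \<epsilon>" "measure \<mu> (band f (t - \<epsilon>) (t + \<epsilon>)) < e"
  proof (rule measure_band_small)
    show "f \<in> borel_measurable \<mu>"
      using cf by (subst measurable_cong_sets[OF sets refl]) (rule borel_measurable_continuous_onI)
  qed (use \<mu>.finite_measure_axioms null sp e in auto)
  let ?B = "band f (t - \<epsilon>) (t + \<epsilon>)"
  obtain r where r: "0 < r" "\<And>y. y \<in> lev f (t + \<epsilon>) \<Longrightarrow> ball y r \<subseteq> lev f t"
    using lev_thickening_subset(2)[OF cf L \<epsilon>(1)] by blast
  \<comment> \<open>The bound \<open>r\<close> gives Lipschitz test functions on balls, the bound
    \<open>e\<close> a small error. The same \<delta> is the mesh of the partition and the bound on
    the displacement by \<open>phi n\<close>.\<close>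
  define \<delta> where "\<delta> = min r e"
  have \<delta>: "0 < \<delta>" "\<delta> \<le> e" using r e by (auto simp: \<delta>_def)
  have ball: "ball y \<delta> \<subseteq> lev f t" if "y \<in> lev f (t + \<epsilon>)" for y
    using r(2)[OF that] by (rule order_trans[rotated]) (auto simp: \<delta>_def)
  obtain \<P> where \<P>: "finite \<P>" "disjoint \<P>" "\<Union>\<P> = lev f (t + \<epsilon>)"
      "\<And>A. A \<in> \<P> \<Longrightarrow> A \<in> sets borel"
      "\<And>A a b. A \<in> \<P> \<Longrightarrow> a \<in> A \<Longrightarrow> b \<in> A \<Longrightarrow> dist a b < \<delta>"
    using compact_finite_borel_partition[OF lev_thickening_subset(1)[OF cf L \<epsilon>(1)] \<delta>(1)] by metis
  have freq: "AE \<omega> in M. (\<lambda>n. (\<Sum>j<n. indicator A (X j \<omega>)) / real n) \<longlonglongrightarrow> measure \<mu> A"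
    if "A \<in> sets borel" for A
    unfolding \<mu>_def
    by (rule AE_empirical_frequency_tendsto[OF indep]) (use ident that in \<open>auto simp: \<mu>_def\<close>)
  have sB: "?B \<in> sets borel"
    unfolding band_def by (intro borel_closed closed_Collect_le closed_Collect_conj continuous_intros cf)
  have "AE \<omega> in M. \<forall>A\<in>\<P>. (\<lambda>n. (\<Sum>j<n. indicator A (X j \<omega>)) / real n) \<longlonglongrightarrow> measure \<mu> A"
    using \<P>(1) by (rule AE_finite_allI) (rule freq[OF \<P>(4)])
  then show ?thesis
    using freq[OF sB] close
  proof eventually_elim
    case (elim \<omega>)
    have "(\<lambda>n. \<Sum>A\<in>\<P>. \<bar>(\<Sum>j<n. indicator A (X j \<omega>)) / real n - measure \<mu> A\<bar>)
        \<longlonglongrightarrow> (\<Sum>A\<in>\<P>. \<bar>measure \<mu> A - measure \<mu> A\<bar>)"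
      using elim(1) by (intro tendsto_intros) auto
    then have "eventually (\<lambda>n. (\<Sum>A\<in>\<P>. \<bar>(\<Sum>j<n. indicator A (X j \<omega>)) / real n - measure \<mu> A\<bar>) < e) sequentially"
      by (rule order_tendstoD(2)) (simp add: e)
    moreover have "eventually (\<lambda>n. (\<Sum>j<n. indicator ?B (X j \<omega>)) / real n < e) sequentially"
      using elim(2) \<epsilon>(2) by (rule order_tendstoD(2))
    moreover have "eventually (\<lambda>n. eps n < \<epsilon>) sequentially"
      using eps \<epsilon>(1) by (rule order_tendstoD(2))
    ultimately show ?case
      using elim(3) phi_id[OF \<delta>(1)] eventually_gt_at_top[of 0]
    proof eventually_elim
      case (elim n)
      have fh: "\<bar>fhat n (sample X n \<omega>) x - f x\<bar> \<le> eps n" for x using elim(4) by blast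
      \<comment> \<open>A selected sample lies in \<open>lev f (t - eps n)\<close>, which is the
        image of the level set under \<open>phi n\<close>; its preimage is therefore in the level
        set, less than \<delta> away.\<close>
      have \<psi>: "inv (phi n) (X j \<omega>) \<in> lev f t \<and> dist (X j \<omega>) (inv (phi n) (X j \<omega>)) < \<delta>"
        if "j \<in> Jn fhat X t n \<omega>" for j
      proof -
        have "X j \<omega> \<in> lev f (t - eps n)"
          using that fh[of "X j \<omega>"] by (auto simp: Jn_def lev_def)
        then obtain x where x: "x \<in> lev f t" "X j \<omega> = phi n x"
          using phi_L[of n] by blast
        have "inv (phi n) (X j \<omega>) = x"
          using x(2) bij[of n] by (simp add: bij_is_inj)
        then show ?thesis
          using x elim(5) by (simp add: dist_norm)
      qed
      show ?case
      proof (intro allI impI)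
        fix w :: "'b \<Rightarrow> real" and g assume w: "\<forall>y. \<bar>w y\<bar> \<le> C" "\<forall>y z. \<bar>w y - w z\<bar> \<le> C * norm (y - z)"
          and g: "unit_W (lev f t) g"
        have "cmod ((\<Sum>j\<in>Jn fhat X t n \<omega>. complex_of_real (w (X j \<omega>)) * g (inv (phi n) (X j \<omega>))) /\<^sub>R real n
            - (LINT y:lev f t|\<mu>. complex_of_real (w y) * g y))
          \<le> C * (5 * \<delta> + (\<Sum>j<n. indicator (band f (t - \<epsilon>) (t + \<epsilon>)) (X j \<omega>)) / real n
               + (\<Sum>A\<in>\<P>. \<bar>(\<Sum>j<n. indicator A (X j \<omega>)) / real n - measure \<mu> A\<bar>)
               + measure \<mu> (band f (t - \<epsilon>) (t + \<epsilon>)))"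
        proof (rule empirical_level_set_bound[where \<xi> = "\<lambda>j. X j \<omega>", OF \<mu> sets cf \<epsilon>(1) _ _ ball \<P>])
          show "t - \<epsilon> \<le> f (X j \<omega>)" if "j \<in> Jn fhat X t n \<omega>" for j
            using that fh[of "X j \<omega>"] elim(3) by (auto simp: Jn_def)
          show "j \<in> Jn fhat X t n \<omega>" if "j < n" "t + \<epsilon> \<le> f (X j \<omega>)" for j
            using that fh[of "X j \<omega>"] elim(3) by (auto simp: Jn_def)
        qed (use \<delta> elim(6) \<psi> w g in \<open>auto simp: Jn_def\<close>)
        also have "\<dots> \<le> C * (9 * e)"
          using elim(1,2) \<epsilon>(2) \<delta>(2) C e by (intro mult_left_mono) linarith+
        finally show "cmod ((\<Sum>j\<in>Jn fhat X t n \<omega>. complex_of_real (w (X j \<omega>)) * g (inv (phi n) (X j \<omega>))) /\<^sub>R real n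
            - (LINT y:lev f t|\<mu>. complex_of_real (w y) * g y)) \<le> \<eta>"
          using Ce by linarith
      qed
    qed
  qed
qed

section \<open>Kernel integrals and their derivatives\<close>

lemma linearization_error_bound:
  fixes \<kappa> :: "'a::real_normed_vector \<Rightarrow> real"
  assumes der: "\<And>x. (\<kappa> has_derivative blinfun_apply (D\<kappa> x)) (at x)"
    and lip: "\<And>x y. norm (D\<kappa> x - D\<kappa> y) \<le> C * norm (x - y)"
    and C: "0 \<le> C"
  shows "\<bar>\<kappa> b - \<kappa> a - D\<kappa> a (b - a)\<bar> \<le> C * (norm (b - a))\<^sup>2"
proof -
  have "norm (\<kappa> b - \<kappa> a - D\<kappa> a (b - a)) \<le> norm (b - a) * (C * norm (b - a))"
  proof (rule differentiable_bound_linearization[where S = "closed_segment a b"])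
    show "a + t *\<^sub>R (b - a) \<in> closed_segment a b" if "t \<in> {0..1}" for t
      using that by (auto simp: closed_segment_def algebra_simps intro!: exI[of _ t])
    show "(\<kappa> has_derivative blinfun_apply (D\<kappa> x)) (at x within closed_segment a b)" for x
      using der by (rule has_derivative_at_withinI)
    fix x assume x: "x \<in> closed_segment a b"
    have "onorm (blinfun_apply (D\<kappa> x) - blinfun_apply (D\<kappa> a)) = norm (D\<kappa> x - D\<kappa> a)"
      by (simp add: norm_blinfun.rep_eq minus_blinfun.rep_eq fun_diff_def)
    also have "\<dots> \<le> C * norm (x - a)" by (rule lip)
    also have "norm (x - a) \<le> norm (b - a)"
      using segment_bound(1)[OF x] by (simp add: norm_minus_commute)
    finally show "onorm (blinfun_apply (D\<kappa> x) - blinfun_apply (D\<kappa> a)) \<le> C * norm (b - a)"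
      using C by (simp add: mult_left_mono)
  qed auto
  then show ?thesis by (simp add: power2_eq_square mult_ac)
qed

text \<open>The linearization error of \<kappa> is quadratic, uniformly in \<open>y\<close>, so it
  can be integrated against a finite measure. The minus sign is the inner derivative of
  \<open>y - z\<close>.\<close>

lemma has_derivative_convolution_integral:
  fixes \<kappa> :: "'a::euclidean_space \<Rightarrow> real" and G :: "'a \<Rightarrow> complex"
  assumes \<mu>: "finite_measure \<mu>" and sets: "sets \<mu> = sets borel"
    and der: "\<And>x. (\<kappa> has_derivative blinfun_apply (D\<kappa> x)) (at x)"
    and bdd: "\<And>x. \<bar>\<kappa> x\<bar> \<le> C" "\<And>x. norm (D\<kappa> x) \<le> C"
    and lip: "\<And>x y. norm (D\<kappa> x - D\<kappa> y) \<le> C * norm (x - y)"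
    and G: "G \<in> borel_measurable \<mu>" "\<And>y. cmod (G y) \<le> 1"
  shows "((\<lambda>z. LINT y|\<mu>. complex_of_real (\<kappa> (y - z)) * G y) has_derivative
          (\<lambda>v. - (LINT y|\<mu>. complex_of_real (D\<kappa> (y - z) v) * G y))) (at z)"
proof -
  interpret finite_measure \<mu> by fact
  have C: "0 \<le> C" using bdd(1)[of 0] by linarith
  have cont_D: "continuous_on UNIV D\<kappa>"
  proof (rule lipschitz_on_continuous_on[of C], rule lipschitz_onI)
    show "dist (D\<kappa> x) (D\<kappa> y) \<le> C * dist x y" for x y
      using lip by (simp add: dist_norm)
  qed (rule C)
  have cont: "continuous_on UNIV \<kappa>"
    using der by (meson continuous_at_imp_continuous_on has_derivative_continuous)
  have m1: "(\<lambda>y. \<kappa> (y - x)) \<in> borel_measurable \<mu>" for x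
    using sets by (subst measurable_cong_sets[OF sets refl])
      (intro borel_measurable_continuous_onI continuous_on_compose2[OF cont] continuous_intros, auto)
  have m2: "(\<lambda>y. D\<kappa> (y - x) v) \<in> borel_measurable \<mu>" for x v
    using sets by (subst measurable_cong_sets[OF sets refl])
      (intro borel_measurable_continuous_onI continuous_intros continuous_on_compose2[OF cont_D], auto)
  have bd: "cmod (complex_of_real r * G y) \<le> \<bar>r\<bar>" for r y
    using mult_left_mono[OF G(2)[of y], of "\<bar>r\<bar>"] by (simp add: norm_mult)
  have i1: "integrable \<mu> (\<lambda>y. complex_of_real (\<kappa> (y - x)) * G y)" for x
    using m1 G(1) bdd(1) by (intro integrable_const_bound[of _ C] AE_I2 order_trans[OF bd]) auto
  have bd2: "\<bar>D\<kappa> x v\<bar> \<le> C * norm v" for x v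
    using norm_blinfun[of "D\<kappa> x" v] mult_right_mono[OF bdd(2)[of x], of "norm v"] by simp
  have i2: "integrable \<mu> (\<lambda>y. complex_of_real (D\<kappa> (y - x) v) * G y)" for x v
    using m2 G(1) bd2
    by (intro integrable_const_bound[of _ "C * norm v"] AE_I2 order_trans[OF bd]) auto
  let ?U = "\<lambda>z. LINT y|\<mu>. complex_of_real (\<kappa> (y - z)) * G y"
  let ?U' = "\<lambda>v. - (LINT y|\<mu>. complex_of_real (D\<kappa> (y - z) v) * G y)"
  let ?m = "measure \<mu> (space \<mu>)"
  show ?thesis
  proof (rule has_derivativeI_sandwich[of 1])
    show "bounded_linear ?U'"
    proof (rule bounded_linear_intro[of _ "C * ?m"])
      show "?U' (v + w) = ?U' v + ?U' w" for v w
        using i2 by (simp add: blinfun.add_right distrib_right)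
      show "?U' (r *\<^sub>R v) = r *\<^sub>R ?U' v" for r v
        by (simp add: blinfun.scaleR_right scaleR_conv_of_real mult.assoc)
      show "norm (?U' v) \<le> norm v * (C * ?m)" for v
      proof -
        have "cmod (LINT y|\<mu>. complex_of_real (D\<kappa> (y - z) v) * G y) \<le> (LINT y|\<mu>. C * norm v)"
          using i2 bd2 by (intro Bochner_Integration.integral_norm_bound_integral order_trans[OF bd]) auto
        then show ?thesis by (simp add: mult_ac)
      qed
    qed
    show "((\<lambda>y. C * ?m * norm (y - z)) \<longlongrightarrow> 0) (at z)"
      by (intro tendsto_eq_intros) auto
    fix x assume "x \<noteq> z"
    \<comment> \<open>The increment of the argument is \<open>(y - x) - (y - z) = - (x - z)\<close>,
      so the integrand below is exactly the linearization error at \<open>y - z\<close>.\<close>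
    have "?U' (x - z) = (LINT y|\<mu>. complex_of_real (D\<kappa> (y - z) ((y - x) - (y - z))) * G y)"
      using blinfun.minus_right[of "D\<kappa> (y - z)" "x - z" for y] by simp
    then have "?U x - ?U z - ?U' (x - z) =
        (LINT y|\<mu>. complex_of_real (\<kappa> (y - x) - \<kappa> (y - z) - D\<kappa> (y - z) ((y - x) - (y - z))) * G y)"
      using i1 i2[of z "z - x"] by (simp add: left_diff_distrib)
    also have "cmod \<dots> \<le> (LINT y|\<mu>. C * (norm (x - z))\<^sup>2)"
    proof (intro Bochner_Integration.integral_norm_bound_integral order_trans[OF bd])
      show "integrable \<mu> (\<lambda>y. complex_of_real (\<kappa> (y - x) - \<kappa> (y - z) - D\<kappa> (y - z) ((y - x) - (y - z))) * G y)"
        using i1 i2[of z "z - x"] by (auto simp: left_diff_distrib intro!: Bochner_Integration.integrable_diff)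
      fix y
      show "\<bar>\<kappa> (y - x) - \<kappa> (y - z) - D\<kappa> (y - z) ((y - x) - (y - z))\<bar> \<le> C * (norm (x - z))\<^sup>2"
        using linearization_error_bound[OF der lip C, of "y - x" "y - z"] by (simp add: norm_minus_commute)
    qed auto
    finally show "norm (?U x - ?U z - ?U' (x - z)) / norm (x - z) \<le> C * ?m * norm (x - z)"
      using \<open>x \<noteq> z\<close> by (simp add: divide_simps power2_eq_square mult_ac)
  qed auto
qed

section \<open>Bounds for a compactly supported kernel and its rescaling\<close>

lemma has_derivative_zero_outside_closed:
  fixes F :: "'a::real_normed_vector \<Rightarrow> 'b::real_normed_vector" and A :: "'a \<Rightarrow>\<^sub>L 'b"
  assumes S: "closed S" and zero: "\<And>x. x \<notin> S \<Longrightarrow> F x = 0" and x: "x \<notin> S"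
    and der: "(F has_derivative blinfun_apply A) (at x)"
  shows "A = 0"
proof -
  have "((\<lambda>_. 0) has_derivative blinfun_apply A) (at x)"
    by (rule has_derivative_transform_within_open[OF der, of "- S"]) (use S x zero in auto)
  then have "blinfun_apply A = (\<lambda>_. 0)"
    by (rule has_derivative_unique) simp
  then show ?thesis by (intro blinfun_eqI) simp
qed

lemma compact_support_bounded:
  fixes F :: "'a::topological_space \<Rightarrow> 'b::real_normed_vector"
  assumes F: "continuous_on UNIV F" and S: "compact S" and F0: "\<And>x. x \<notin> S \<Longrightarrow> F x = 0"
  shows "\<exists>B. \<forall>x. norm (F x) \<le> B"
proof -
  have "bounded (F ` S)"
    using S by (intro compact_imp_bounded compact_continuous_image continuous_on_subset[OF F]) auto
  then obtain B where B: "\<And>x. x \<in> S \<Longrightarrow> norm (F x) \<le> B" unfolding bounded_iff by auto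
  have "norm (F x) \<le> max B 0" for x
    using B[of x] F0[of x] by (cases "x \<in> S") auto
  then show ?thesis by blast
qed

text \<open>The complement of the compact set is open, so both derivatives vanish there together
  with \<open>k\<close>; on the compact set continuity gives the bounds.\<close>

lemma compact_support_C2_bounded:
  fixes k :: "'a::euclidean_space \<Rightarrow> real" and Dk :: "'a \<Rightarrow> 'a \<Rightarrow>\<^sub>L real"
    and D2k :: "'a \<Rightarrow> 'a \<Rightarrow>\<^sub>L 'a \<Rightarrow>\<^sub>L real"
  assumes Dk: "\<And>x. (k has_derivative blinfun_apply (Dk x)) (at x)"
    and D2k: "\<And>x. (Dk has_derivative blinfun_apply (D2k x)) (at x)"
    and cont: "continuous_on UNIV D2k"
    and S: "compact S" and zero: "\<And>x. x \<notin> S \<Longrightarrow> k x = 0"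
  obtains C where "0 \<le> C" "\<And>x. \<bar>k x\<bar> \<le> C" "\<And>x. norm (Dk x) \<le> C" "\<And>x. norm (D2k x) \<le> C"
proof -
  have z1: "Dk x = 0" if "x \<notin> S" for x
    by (rule has_derivative_zero_outside_closed[OF compact_imp_closed[OF S] zero that Dk])
  have z2: "D2k x = 0" if "x \<notin> S" for x
    by (rule has_derivative_zero_outside_closed[OF compact_imp_closed[OF S] z1 that D2k])
  have c0: "continuous_on UNIV k" and c1: "continuous_on UNIV Dk"
    using Dk D2k by (meson continuous_at_imp_continuous_on has_derivative_continuous)+
  obtain B0 B1 B2 where B: "\<And>x. norm (k x) \<le> B0" "\<And>x. norm (Dk x) \<le> B1" "\<And>x. norm (D2k x) \<le> B2"
    using compact_support_bounded[OF c0 S zero] compact_support_bounded[OF c1 S z1]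
      compact_support_bounded[OF cont S z2] by auto
  define C where "C = max 0 (max B0 (max B1 B2))"
  have "norm (k x) \<le> C" "norm (Dk x) \<le> C" "norm (D2k x) \<le> C" for x
    using B[of x] unfolding C_def by linarith+
  then show ?thesis by (intro that[of C]) (auto simp: C_def)
qed

lemma lipschitz_of_bounded_derivative:
  fixes F :: "'a::real_normed_vector \<Rightarrow> 'b::real_normed_vector"
  assumes der: "\<And>x. (F has_derivative blinfun_apply (F' x)) (at x)" and bd: "\<And>x. norm (F' x) \<le> C"
  shows "norm (F x - F y) \<le> C * norm (x - y)"
  by (rule differentiable_bound[of UNIV F "\<lambda>x. blinfun_apply (F' x)"])
     (use der bd in \<open>auto simp: norm_blinfun.rep_eq[symmetric]\<close>)

lemma rescaled_kernel_bounds: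
  fixes k :: "'a::euclidean_space \<Rightarrow> real" and Dk :: "'a \<Rightarrow> 'a \<Rightarrow>\<^sub>L real"
    and D2k :: "'a \<Rightarrow> 'a \<Rightarrow>\<^sub>L 'a \<Rightarrow>\<^sub>L real"
  assumes Dk: "\<And>x. (k has_derivative blinfun_apply (Dk x)) (at x)"
    and D2k: "\<And>x. (Dk has_derivative blinfun_apply (D2k x)) (at x)"
    and cont: "continuous_on UNIV D2k"
    and S: "compact S" and zero: "\<And>x. x \<notin> S \<Longrightarrow> k x = 0" and h: "0 < h"
  obtains C and D\<kappa> :: "'a \<Rightarrow> 'a \<Rightarrow>\<^sub>L real" where "0 \<le> C"
    "\<And>x. (kh k h has_derivative blinfun_apply (D\<kappa> x)) (at x)"
    "\<And>x. \<bar>kh k h x\<bar> \<le> C" "\<And>x. norm (D\<kappa> x) \<le> C"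
    "\<And>x y. norm (D\<kappa> x - D\<kappa> y) \<le> C * norm (x - y)"
proof -
  obtain C where C: "0 \<le> C" "\<And>x. \<bar>k x\<bar> \<le> C" "\<And>x. norm (Dk x) \<le> C" "\<And>x. norm (D2k x) \<le> C"
    using compact_support_C2_bounded[OF Dk D2k cont S zero] by blast
  define D\<kappa> where "D\<kappa> x = Dk (x /\<^sub>R h) /\<^sub>R h" for x
  \<comment> \<open>Each derivative of the rescaled kernel costs a factor \<open>1 / h\<close>; the
    sum dominates all three bounds.\<close>
  define C' where "C' = C + C / h + C / h\<^sup>2"
  have C': "0 \<le> C'" "C \<le> C'" "C / h \<le> C'" "C / h\<^sup>2 \<le> C'"
    using C(1) h by (auto simp: C'_def)
  show ?thesis
  proof (rule that[of C' D\<kappa>])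
    show "(kh k h has_derivative blinfun_apply (D\<kappa> x)) (at x)" for x
    proof -
      have "((\<lambda>x. x /\<^sub>R h) has_derivative (\<lambda>x. x /\<^sub>R h)) (at x)"
        by (auto intro!: derivative_eq_intros)
      from has_derivative_compose[OF this Dk]
      have "((\<lambda>x. k (x /\<^sub>R h)) has_derivative (\<lambda>v. Dk (x /\<^sub>R h) (v /\<^sub>R h))) (at x)" .
      moreover have "(\<lambda>v. Dk (x /\<^sub>R h) (v /\<^sub>R h)) = blinfun_apply (D\<kappa> x)"
        by (auto simp: D\<kappa>_def blinfun.scaleR_left blinfun.scaleR_right)
      ultimately show ?thesis by (simp add: kh_def[abs_def])
    qed
    show "\<bar>kh k h x\<bar> \<le> C'" for x using C(2)[of "x /\<^sub>R h"] C'(2) by (simp add: kh_def)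
    show "norm (D\<kappa> x) \<le> C'" for x
    proof -
      have "norm (D\<kappa> x) = norm (Dk (x /\<^sub>R h)) / h" using h by (simp add: D\<kappa>_def divide_inverse)
      also have "\<dots> \<le> C / h" using C(3) h by (intro divide_right_mono) auto
      finally show ?thesis using C'(3) by simp
    qed
    show "norm (D\<kappa> x - D\<kappa> y) \<le> C' * norm (x - y)" for x y
    proof -
      have "norm (D\<kappa> x - D\<kappa> y) = norm (Dk (x /\<^sub>R h) - Dk (y /\<^sub>R h)) / h"
        using h by (simp add: D\<kappa>_def divide_inverse scaleR_diff_right[symmetric] del: scaleR_diff_right)
      also have "\<dots> \<le> C * norm (x /\<^sub>R h - y /\<^sub>R h) / h"
        using lipschitz_of_bounded_derivative[OF D2k C(4)] h by (intro divide_right_mono) auto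
      also have "\<dots> = C / h\<^sup>2 * norm (x - y)"
        using h by (simp add: scaleR_diff_right[symmetric] power2_eq_square divide_inverse del: scaleR_diff_right)
      also have "\<dots> \<le> C' * norm (x - y)" using C'(4) by (rule mult_right_mono) simp
      finally show ?thesis .
    qed
  qed (rule C')
qed

section \<open>Perturbation of quotients\<close>

lemma quotient_difference_bound:
  fixes a b a1 b1 :: complex
  assumes "b \<noteq> 0" "0 < c" "c \<le> cmod b1"
    and "cmod (a1 - a) \<le> s" "cmod (b1 - b) \<le> r" "cmod (a / b) \<le> q"
  shows "cmod (a1 / b1 - a / b) \<le> (s + q * r) / c"
proof -
  have b1: "b1 \<noteq> 0" using assms by auto
  \<comment> \<open>This form of the difference involves only the limit quotient and a division by
    \<open>b1\<close>.\<close>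
  have "a1 / b1 - a / b = ((a1 - a) - (a / b) * (b1 - b)) / b1"
    using assms(1) b1 by (simp add: field_simps)
  then have "cmod (a1 / b1 - a / b) = cmod ((a1 - a) - (a / b) * (b1 - b)) / cmod b1"
    by (simp add: norm_divide)
  also have "\<dots> \<le> (s + q * r) / c"
  proof (rule frac_le)
    have "0 \<le> q" using assms(6) norm_ge_zero order_trans by blast
    then have "cmod ((a / b) * (b1 - b)) \<le> q * r"
      unfolding norm_mult using assms by (intro mult_mono) auto
    then show "cmod ((a1 - a) - (a / b) * (b1 - b)) \<le> s + q * r"
      using norm_triangle_ineq4[of "a1 - a" "(a / b) * (b1 - b)"] assms(4) by linarith
    then show "0 \<le> s + q * r" using norm_ge_zero order_trans by blast
  qed (use assms in auto)
  finally show ?thesis .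
qed

text \<open>If primes denote derivatives, \<open>(a' - a / b * b') / b\<close> is the derivative of
  the quotient, so values and derivatives are treated together. \<open>B\<close> depends only on
  \<open>c\<close> and \<open>C\<close>, which makes the bound uniform in the point, the direction
  and the test function.\<close>

lemma quotient_perturbation:
  fixes c C :: real
  assumes c: "0 < c" and C: "0 \<le> C"
  obtains B where "0 \<le> B"
    "\<And>s a a1 b b1 a' a1' b' b1'. \<lbrakk>0 \<le> s; s \<le> 1; c \<le> cmod b; c / 2 \<le> cmod b1;
        cmod a \<le> C; cmod a' \<le> C; cmod b' \<le> C;
        cmod (a1 - a) \<le> s; cmod (b1 - b) \<le> s; cmod (a1' - a') \<le> s; cmod (b1' - b') \<le> s\<rbrakk>
      \<Longrightarrow> cmod (a1 / b1 - a / b) \<le> B * s \<and>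
          cmod ((a1' - a1 / b1 * b1') / b1 - (a' - a / b * b') / b) \<le> B * s"
proof -
  \<comment> \<open>\<open>R\<close> bounds the limit quotient and \<open>R2\<close> its derivative;
    \<open>B1\<close> and \<open>B3\<close> are the rates for the quotient and for the numerator of
    its derivative.\<close>
  define R where "R = C / c"
  define B1 where "B1 = 2 * (1 + R) / c"
  define R2 where "R2 = (C + R * C) / c"
  define B3 where "B3 = 1 + (R + B1) + B1 * C"
  define B where "B = B1 + 2 * (B3 + R2) / c"
  have nn: "0 \<le> R" "0 \<le> B1" "0 \<le> R2" "0 \<le> B3"
    using c C by (auto simp: R_def B1_def R2_def B3_def)
  then have B: "B1 \<le> B" "2 * (B3 + R2) / c \<le> B" "0 \<le> B"
    using c by (auto simp: B_def)
  show ?thesis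
  proof (rule that[of B])
    fix s :: real and a a1 b b1 a' a1' b' b1' :: complex
    assume s: "0 \<le> s" "s \<le> 1" and b: "c \<le> cmod b" "c / 2 \<le> cmod b1"
      and bd: "cmod a \<le> C" "cmod a' \<le> C" "cmod b' \<le> C"
      and d: "cmod (a1 - a) \<le> s" "cmod (b1 - b) \<le> s" "cmod (a1' - a') \<le> s" "cmod (b1' - b') \<le> s"
    have b0: "b \<noteq> 0" using b c by auto
    have q: "cmod (a / b) \<le> R"
      unfolding norm_divide R_def using bd b c C by (intro frac_le) auto
    have q1: "cmod (a1 / b1 - a / b) \<le> B1 * s"
      using quotient_difference_bound[OF b0 _ b(2) d(1,2) q] c
      by (simp add: B1_def field_simps)
    \<comment> \<open>Here \<open>s \<le> 1\<close> turns the error bound into a fixed bound for the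
      perturbed quotient.\<close>
    have "B1 * s \<le> B1" using nn s by (simp add: mult_left_le)
    then have q1n: "cmod (a1 / b1) \<le> R + B1"
      using q q1 norm_triangle_ineq[of "a1 / b1 - a / b" "a / b"] by simp
    let ?A = "a' - a / b * b'" and ?A1 = "a1' - a1 / b1 * b1'"
    have "cmod ?A \<le> C + R * C"
      using norm_triangle_ineq4[of a' "a / b * b'"] bd(2) mult_mono[OF q bd(3)] nn
      by (simp add: norm_mult del: times_divide_eq_left)
    then have A: "cmod (?A / b) \<le> R2"
      unfolding norm_divide R2_def using b c nn C by (intro frac_le) auto
    have "(a1' - x1 * b1') - (a' - x * b') = (a1' - a') - x1 * (b1' - b') - (x1 - x) * b'" for x x1
      by (simp add: algebra_simps)
    then have "?A1 - ?A = (a1' - a') - a1 / b1 * (b1' - b') - (a1 / b1 - a / b) * b'" .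
    also have "cmod \<dots> \<le> cmod (a1' - a') + cmod (a1 / b1) * cmod (b1' - b') + cmod (a1 / b1 - a / b) * cmod b'"
      unfolding norm_mult[symmetric]
      by (rule order_trans[OF norm_triangle_ineq4] add_right_mono norm_triangle_ineq4)+
    also have "\<dots> \<le> s + (R + B1) * s + (B1 * s) * C"
      using d q1n q1 bd nn s by (intro add_mono mult_mono) auto
    also have "\<dots> = B3 * s" by (simp add: B3_def algebra_simps)
    finally have A1: "cmod (?A1 - ?A) \<le> B3 * s" .
    have "cmod (?A1 / b1 - ?A / b) \<le> (B3 * s + R2 * s) / (c / 2)"
      using quotient_difference_bound[OF b0 _ b(2) A1 d(2) A] c by simp
    also have "\<dots> = 2 * (B3 + R2) / c * s" by (simp add: field_simps)
    also have "\<dots> \<le> B * s" using B(2) s(1) by (rule mult_right_mono)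
    finally have "cmod (?A1 / b1 - ?A / b) \<le> B * s" .
    moreover have "B1 * s \<le> B * s" using B(1) s(1) by (rule mult_right_mono)
    ultimately show "cmod (a1 / b1 - a / b) \<le> B * s \<and> cmod (?A1 / b1 - ?A / b) \<le> B * s"
      using q1 by linarith
  qed (rule B)
qed

section \<open>Weighted integrals and weighted empirical averages of test functions\<close>

definition int_op :: "'a measure \<Rightarrow> 'a set \<Rightarrow> ('a \<Rightarrow> real) \<Rightarrow> ('a \<Rightarrow> complex) \<Rightarrow> complex" where
  "int_op \<mu> L w g = (LINT y:L|\<mu>. complex_of_real (w y) * g y)"

text \<open>Division by \<open>n\<close>, not by the size of \<open>J\<close>, puts the law of large
  numbers for \<mu> itself in place of the conditional law; the normalisation cancels in
  quotients.\<close>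

definition emp_op :: "nat \<Rightarrow> nat set \<Rightarrow> (nat \<Rightarrow> 'a) \<Rightarrow> ('a \<Rightarrow> 'a) \<Rightarrow> ('a \<Rightarrow> real) \<Rightarrow> ('a \<Rightarrow> complex) \<Rightarrow> complex" where
  "emp_op n J \<xi> \<psi> w g = (\<Sum>j\<in>J. complex_of_real (w (\<xi> j)) * g (\<psi> (\<xi> j))) /\<^sub>R real n"

lemma borel_measurable_unit_W_indicator:
  fixes L :: "'a::euclidean_space set"
  assumes "sets \<mu> = sets borel" "closed L" "unit_W L g"
  shows "(\<lambda>y. indicator L y *\<^sub>R g y) \<in> borel_measurable \<mu>"
  using assms unit_W_continuous_on[OF assms(3)]
  by (subst measurable_cong_sets[OF assms(1) refl])
     (intro borel_measurable_continuous_on_indicator, auto)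

lemma cmod_unit_W_indicator: "unit_W L g \<Longrightarrow> cmod (indicator L y *\<^sub>R g y) \<le> 1"
  using unit_W_norm[of L g y] by (auto simp: indicator_def)

lemma int_op_eq: "int_op \<mu> L w g = (LINT y|\<mu>. complex_of_real (w y) * (indicator L y *\<^sub>R g y))"
  by (simp add: int_op_def set_lebesgue_integral_def)

lemma integrable_int_op:
  fixes L :: "'a::euclidean_space set"
  assumes \<mu>: "finite_measure \<mu>" and sets: "sets \<mu> = sets borel" and L: "closed L" and g: "unit_W L g"
    and w: "continuous_on UNIV w" "\<And>y. \<bar>w y\<bar> \<le> C"
  shows "integrable \<mu> (\<lambda>y. complex_of_real (w y) * (indicator L y *\<^sub>R g y))"
proof -
  interpret finite_measure \<mu> by fact
  have "w \<in> borel_measurable \<mu>"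
    by (subst measurable_cong_sets[OF sets refl]) (rule borel_measurable_continuous_onI[OF w(1)])
  then have m: "(\<lambda>y. complex_of_real (w y) * (indicator L y *\<^sub>R g y)) \<in> borel_measurable \<mu>"
    using borel_measurable_unit_W_indicator[OF sets L g] by (intro borel_measurable_times) auto
  have "0 \<le> C" using w(2)[of undefined] by linarith
  then have "cmod (complex_of_real (w y) * (indicator L y *\<^sub>R g y)) \<le> C * 1" for y
    unfolding norm_mult norm_of_real
    using w(2) cmod_unit_W_indicator[OF g] by (intro mult_mono) auto
  then show ?thesis by (intro integrable_const_bound[of _ C] m) auto
qed

lemma int_op_diff_bound:
  fixes L :: "'a::euclidean_space set"
  assumes \<mu>: "prob_space \<mu>" and sets: "sets \<mu> = sets borel" and L: "closed L" and g: "unit_W L g"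
    and w: "continuous_on UNIV w" "\<And>y. \<bar>w y\<bar> \<le> C" and w': "continuous_on UNIV w'" "\<And>y. \<bar>w' y\<bar> \<le> C'"
    and s: "\<And>y. \<bar>w y - w' y\<bar> \<le> s"
  shows "cmod (int_op \<mu> L w g - int_op \<mu> L w' g) \<le> s"
proof -
  interpret prob_space \<mu> by fact
  note i = integrable_int_op[OF finite_measure_axioms sets L g]
  have "int_op \<mu> L w g - int_op \<mu> L w' g =
      (LINT y|\<mu>. complex_of_real (w y) * (indicator L y *\<^sub>R g y) - complex_of_real (w' y) * (indicator L y *\<^sub>R g y))"
    unfolding int_op_eq using i[OF w] i[OF w'] by (rule Bochner_Integration.integral_diff[symmetric])
  moreover have "cmod (LINT y|\<mu>. complex_of_real (w y) * (indicator L y *\<^sub>R g y)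
      - complex_of_real (w' y) * (indicator L y *\<^sub>R g y)) \<le> (LINT y|\<mu>. s)"
  proof (rule Bochner_Integration.integral_norm_bound_integral)
    fix y
    have "0 \<le> s" using s[of y] by linarith
    then have "cmod (complex_of_real (w y - w' y) * (indicator L y *\<^sub>R g y)) \<le> s * 1"
      unfolding norm_mult norm_of_real
      using s cmod_unit_W_indicator[OF g] by (intro mult_mono) auto
    then show "cmod (complex_of_real (w y) * (indicator L y *\<^sub>R g y)
        - complex_of_real (w' y) * (indicator L y *\<^sub>R g y)) \<le> s"
      by (simp only: of_real_diff left_diff_distrib mult_1_right)
  qed (use i[OF w] i[OF w'] in simp_all)
  ultimately show ?thesis by (simp add: prob_space)
qed

lemma int_op_bound:
  fixes L :: "'a::euclidean_space set"
  assumes "prob_space \<mu>" "sets \<mu> = sets borel" "closed L" "unit_W L g"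
    "continuous_on UNIV w" "\<And>y. \<bar>w y\<bar> \<le> C"
  shows "cmod (int_op \<mu> L w g) \<le> C"
  using int_op_diff_bound[OF assms, of "\<lambda>_. 0" 0 C] assms(6) by (simp add: int_op_def)

lemma continuous_on_kernel_shift:
  fixes F :: "'a::real_normed_vector \<Rightarrow> 'b::topological_space"
  assumes "continuous_on UNIV F"
  shows "continuous_on UNIV (\<lambda>y. F (y - z))"
  by (intro continuous_on_compose2[OF assms] continuous_intros) auto

lemma blinfun_apply_le:
  fixes A :: "'a::real_normed_vector \<Rightarrow>\<^sub>L real"
  assumes "norm A \<le> C"
  shows "\<bar>A v\<bar> \<le> C * norm v"
  using norm_blinfun[of A v] mult_right_mono[OF assms, of "norm v"] by simp

locale smooth_kernel =
  fixes \<kappa> :: "'a::euclidean_space \<Rightarrow> real" and D\<kappa> :: "'a \<Rightarrow> 'a \<Rightarrow>\<^sub>L real" and C :: real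
  assumes C: "0 \<le> C"
    and der: "\<And>x. (\<kappa> has_derivative blinfun_apply (D\<kappa> x)) (at x)"
    and bdd: "\<And>x. \<bar>\<kappa> x\<bar> \<le> C" "\<And>x. norm (D\<kappa> x) \<le> C"
    and D_lip: "\<And>x y. norm (D\<kappa> x - D\<kappa> y) \<le> C * norm (x - y)"
begin

lemma lip: "\<bar>\<kappa> x - \<kappa> y\<bar> \<le> C * norm (x - y)"
  using lipschitz_of_bounded_derivative[OF der bdd(2)] by simp

lemma D_apply_le: "\<bar>D\<kappa> x v\<bar> \<le> C * norm v"
  by (rule blinfun_apply_le[OF bdd(2)])

lemma D_apply_lip: "\<bar>D\<kappa> x v - D\<kappa> y v\<bar> \<le> C * norm (x - y) * norm v"
  using blinfun_apply_le[OF D_lip] by (simp add: blinfun.diff_left)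

lemma continuous_shift: "continuous_on UNIV (\<lambda>y. \<kappa> (y - z))"
  by (rule continuous_on_kernel_shift)
     (use der in \<open>meson continuous_at_imp_continuous_on has_derivative_continuous\<close>)

lemma continuous_D_shift: "continuous_on UNIV (\<lambda>y. D\<kappa> (y - z) v)"
proof (intro continuous_intros continuous_on_kernel_shift)
  show "continuous_on UNIV D\<kappa>"
  proof (rule lipschitz_on_continuous_on[of C], rule lipschitz_onI)
    show "dist (D\<kappa> x) (D\<kappa> y) \<le> C * dist x y" for x y
      using D_lip by (simp add: dist_norm)
  qed (rule C)
qed

lemma has_derivative_int_op:
  assumes "finite_measure \<mu>" "sets \<mu> = sets borel" "closed L" "unit_W L g"
  shows "((\<lambda>z. int_op \<mu> L (\<lambda>y. \<kappa> (y - z)) g) has_derivative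
          (\<lambda>v. - int_op \<mu> L (\<lambda>y. D\<kappa> (y - z) v) g)) (at z)"
  unfolding int_op_eq
  by (rule has_derivative_convolution_integral[OF assms(1,2) der bdd D_lip
        borel_measurable_unit_W_indicator[OF assms(2-4)] cmod_unit_W_indicator[OF assms(4)]])

lemma has_derivative_emp_op:
  assumes phi: "(phi has_derivative blinfun_apply A) (at x)"
  shows "((\<lambda>x. emp_op n J \<xi> \<psi> (\<lambda>y. \<kappa> (y - phi x)) g) has_derivative
          (\<lambda>v. - emp_op n J \<xi> \<psi> (\<lambda>y. D\<kappa> (y - phi x) (A v)) g)) (at x)"
proof -
  have s: "((\<lambda>x. \<kappa> (y - phi x)) has_derivative (\<lambda>v. D\<kappa> (y - phi x) (- A v))) (at x)" for y
    by (rule has_derivative_compose[OF _ der]) (auto intro!: derivative_eq_intros phi)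
  have "((\<lambda>x. emp_op n J \<xi> \<psi> (\<lambda>y. \<kappa> (y - phi x)) g) has_derivative
      (\<lambda>v. (\<Sum>j\<in>J. complex_of_real (D\<kappa> (\<xi> j - phi x) (- A v)) * g (\<psi> (\<xi> j))) /\<^sub>R real n)) (at x)"
    unfolding emp_op_def
    by (intro has_derivative_scaleR_right has_derivative_sum has_derivative_mult_left has_derivative_of_real s)
  then show ?thesis
    by (simp add: emp_op_def blinfun.minus_right sum_negf)
qed

text \<open>The uniform law of large numbers compares both operators at the same weight, at cost
  \<eta>. Moving the weight from \<open>z\<close> and \<open>A\<close> to \<open>x\<close> and the
  identity costs at most \<open>3 * C * \<eta>\<close>.\<close>

lemma emp_op_int_op_bounds:
  assumes \<mu>: "prob_space \<mu>" "sets \<mu> = sets borel" and L: "closed L" and g: "unit_W L g"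
    and \<eta>: "0 \<le> \<eta>" "\<eta> \<le> 1" and z: "norm (z - x) \<le> \<eta>" and A: "norm (A - id_blinfun) \<le> \<eta>"
    and unif: "\<And>w. (\<And>y. \<bar>w y\<bar> \<le> 2 * C) \<Longrightarrow> (\<And>y y'. \<bar>w y - w y'\<bar> \<le> 2 * C * norm (y - y')) \<Longrightarrow>
        cmod (emp_op n J \<xi> \<psi> w g - int_op \<mu> L w g) \<le> \<eta>"
  shows "cmod (emp_op n J \<xi> \<psi> (\<lambda>y. \<kappa> (y - z)) g - int_op \<mu> L (\<lambda>y. \<kappa> (y - x)) g) \<le> (3 * C + 1) * \<eta>"
    and "norm v \<le> 1 \<Longrightarrow>
      cmod (emp_op n J \<xi> \<psi> (\<lambda>y. D\<kappa> (y - z) (A v)) g - int_op \<mu> L (\<lambda>y. D\<kappa> (y - x) v) g) \<le> (3 * C + 1) * \<eta>"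
proof -
  have tri: "cmod (p - r) \<le> (3 * C + 1) * \<eta>" if "cmod (p - q) \<le> \<eta>" "cmod (q - r) \<le> 3 * C * \<eta>" for p q r :: complex
    using norm_triangle_ineq[of "p - q" "q - r"] that by (simp add: algebra_simps)
  show "cmod (emp_op n J \<xi> \<psi> (\<lambda>y. \<kappa> (y - z)) g - int_op \<mu> L (\<lambda>y. \<kappa> (y - x)) g) \<le> (3 * C + 1) * \<eta>"
  proof (rule tri[OF unif int_op_diff_bound[OF \<mu> L g continuous_shift bdd(1) continuous_shift bdd(1)]])
    show "\<bar>\<kappa> (y - z)\<bar> \<le> 2 * C" for y using bdd(1)[of "y - z"] C by linarith
    show "\<bar>\<kappa> (y - z) - \<kappa> (y' - z)\<bar> \<le> 2 * C * norm (y - y')" for y y'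
      using lip[of "y - z" "y' - z"] C mult_nonneg_nonneg[OF C norm_ge_zero[of "y - y'"]] by simp
    show "\<bar>\<kappa> (y - z) - \<kappa> (y - x)\<bar> \<le> 3 * C * \<eta>" for y
    proof -
      have "\<bar>\<kappa> (y - z) - \<kappa> (y - x)\<bar> \<le> C * norm (z - x)"
        using lip[of "y - z" "y - x"] by (simp add: norm_minus_commute)
      also have "\<dots> \<le> C * \<eta>" using z C by (rule mult_left_mono)
      also have "\<dots> \<le> 3 * C * \<eta>" using C \<eta> by simp
      finally show ?thesis .
    qed
  qed
  assume v: "norm v \<le> 1"
  have Av: "norm (A v - v) \<le> \<eta>"
  proof -
    have "norm (A v - v) = norm ((A - id_blinfun) v)" by (simp add: blinfun.diff_left)
    also have "\<dots> \<le> norm (A - id_blinfun) * norm v" by (rule norm_blinfun)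
    also have "\<dots> \<le> \<eta> * 1" using A v \<eta> by (intro mult_mono) auto
    finally show ?thesis by simp
  qed
  \<comment> \<open>The origin of the constant \<open>2 * C\<close> in the class of weights.\<close>
  then have Av2: "norm (A v) \<le> 2"
    using norm_triangle_ineq[of "A v - v" v] v \<eta> by simp
  have bA: "\<bar>D\<kappa> y (A v)\<bar> \<le> 2 * C" for y
    using D_apply_le[of y "A v"] mult_left_mono[OF Av2 C] by linarith
  have bv: "\<bar>D\<kappa> y v\<bar> \<le> C" for y
    using D_apply_le[of y v] mult_left_mono[OF v C] by linarith
  show "cmod (emp_op n J \<xi> \<psi> (\<lambda>y. D\<kappa> (y - z) (A v)) g - int_op \<mu> L (\<lambda>y. D\<kappa> (y - x) v) g) \<le> (3 * C + 1) * \<eta>"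
  proof (rule tri[OF unif int_op_diff_bound[OF \<mu> L g continuous_D_shift bA continuous_D_shift bv]])
    show "\<bar>D\<kappa> (y - z) (A v)\<bar> \<le> 2 * C" for y by (rule bA)
    show "\<bar>D\<kappa> (y - z) (A v) - D\<kappa> (y' - z) (A v)\<bar> \<le> 2 * C * norm (y - y')" for y y'
    proof -
      have "\<bar>D\<kappa> (y - z) (A v) - D\<kappa> (y' - z) (A v)\<bar> \<le> C * norm (y - y') * norm (A v)"
        using D_apply_lip[of "y - z" "A v" "y' - z"] by simp
      also have "\<dots> \<le> C * norm (y - y') * 2" using Av2 C by (intro mult_left_mono) auto
      finally show ?thesis by simp
    qed
    \<comment> \<open>Moving the base point costs \<open>2 * C * \<eta>\<close>, moving the
      direction from \<open>A v\<close> to \<open>v\<close> costs \<open>C * \<eta>\<close>.\<close>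
    show "\<bar>D\<kappa> (y - z) (A v) - D\<kappa> (y - x) v\<bar> \<le> 3 * C * \<eta>" for y
    proof -
      have "\<bar>D\<kappa> (y - z) (A v) - D\<kappa> (y - x) (A v)\<bar> \<le> C * norm (z - x) * norm (A v)"
        using D_apply_lip[of "y - z" "A v" "y - x"] by (simp add: norm_minus_commute)
      also have "\<dots> \<le> C * \<eta> * 2" using z Av2 C \<eta> by (intro mult_mono) auto
      finally have 1: "\<bar>D\<kappa> (y - z) (A v) - D\<kappa> (y - x) (A v)\<bar> \<le> C * \<eta> * 2" .
      have "\<bar>D\<kappa> (y - x) (A v) - D\<kappa> (y - x) v\<bar> \<le> C * norm (A v - v)"
        using D_apply_le[of "y - x" "A v - v"] by (simp add: blinfun.diff_right)
      also have "\<dots> \<le> C * \<eta>" using Av C by (rule mult_left_mono)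
      finally show ?thesis using 1 by linarith
    qed
  qed
qed

end

section \<open>Positivity of the limiting denominator\<close>

lemma measure_density_open_pos:
  fixes f :: "'a::euclidean_space \<Rightarrow> real"
  assumes f: "f \<in> borel_measurable borel" and U: "open U" "U \<noteq> {}" and pos: "\<And>x. x \<in> U \<Longrightarrow> 0 < f x"
  shows "emeasure (density lborel (\<lambda>x. ennreal (f x))) U \<noteq> 0"
proof
  assume "emeasure (density lborel (\<lambda>x. ennreal (f x))) U = 0"
  then have "U \<in> null_sets (density lborel (\<lambda>x. ennreal (f x)))"
    using U by (auto simp: null_sets_def)
  then have "AE x in lborel. x \<in> U \<longrightarrow> ennreal (f x) = 0"
    using f by (subst (asm) null_sets_density_iff) auto
  then have "AE x in lborel. x \<notin> U"
  proof eventually_elim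
    case (elim x)
    then show ?case using pos[of x] by (auto simp: ennreal_eq_0_iff)
  qed
  then have "U \<in> null_sets lborel" using U by (subst AE_iff_null_sets) auto
  then have "negligible U"
    by (simp add: negligible_iff_null_sets null_sets_completionI)
  then show False using open_not_negligible U by blast
qed

text \<open>At a boundary point a short step in a direction of increase raises \<open>f\<close>
  above \<open>t\<close>. Thus every ball around a point of the level set meets an open set on which
  the density is positive.\<close>

lemma superlevel_point_near:
  fixes f :: "'a::euclidean_space \<Rightarrow> real" and Df :: "'a \<Rightarrow> 'a \<Rightarrow>\<^sub>L real"
  assumes der: "\<And>x. (f has_derivative blinfun_apply (Df x)) (at x)"
    and cont: "continuous_on UNIV Df" and reg: "\<And>x. f x = t \<Longrightarrow> Df x \<noteq> 0"
    and x: "t \<le> f x" and r: "0 < r"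
  shows "\<exists>z\<in>ball x r. t < f z"
proof (cases "f x = t")
  case True
  obtain u where u: "0 < Df x u" using reg[OF True] by (rule blinfun_positive_direction)
  then have "u \<noteq> 0" by auto
  obtain q where q: "0 < q" "\<And>z. z \<in> ball x q \<Longrightarrow> 0 < Df z u"
    using ball_derivative_positive[OF cont u] by blast
  define s where "s = min q r / (2 * norm u)"
  have s: "0 < s" using q r \<open>u \<noteq> 0\<close> by (simp add: s_def)
  have "norm (s *\<^sub>R u) = min q r / 2" using q(1) r \<open>u \<noteq> 0\<close> by (simp add: s_def abs_of_pos)
  moreover have "dist x (x + s *\<^sub>R u) = norm (s *\<^sub>R u)" by (simp add: dist_norm)
  ultimately have d: "dist x (x + s *\<^sub>R u) < min q r" using q(1) r by linarith
  have "f x < f (x + s *\<^sub>R u)"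
    by (rule strictly_increasing_along_direction[OF der, of "ball x q"]) (use q d s in auto)
  then show ?thesis using True d by (intro bexI[of _ "x + s *\<^sub>R u"]) auto
qed (use x r in \<open>auto intro!: bexI[of _ x]\<close>)

lemma int_op_one_eq:
  "int_op \<mu> L w (\<lambda>_. 1) = complex_of_real (LINT y:L|\<mu>. w y)"
  unfolding int_op_def set_lebesgue_integral_def
  by (subst integral_complex_of_real[symmetric])
     (auto intro!: Bochner_Integration.integral_cong simp: indicator_def)

text \<open>The denominator is continuous and attains its minimum on the compact set. At the
  minimizer the kernel is at least \<open>c\<close> on a ball that carries mass.\<close>

lemma (in smooth_kernel) int_op_one_lower_bound:
  fixes \<mu> :: "'a measure"
  assumes \<mu>: "prob_space \<mu>" and sets: "sets \<mu> = sets borel" and L: "compact L" "L \<noteq> {}"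
    and c: "0 < c" "0 < r" and low: "\<And>x. norm x \<le> r \<Longrightarrow> c \<le> \<kappa> x" and nonneg: "\<And>x. 0 \<le> \<kappa> x"
    and mass: "\<And>x. x \<in> L \<Longrightarrow> measure \<mu> (L \<inter> ball x r) \<noteq> 0"
  shows "\<exists>c0>0. \<forall>x\<in>L. c0 \<le> cmod (int_op \<mu> L (\<lambda>y. \<kappa> (y - x)) (\<lambda>_. 1))"
proof -
  interpret prob_space \<mu> by fact
  let ?K = "\<lambda>x. cmod (int_op \<mu> L (\<lambda>y. \<kappa> (y - x)) (\<lambda>_. 1))"
  have clL: "closed L" using L(1) by (rule compact_imp_closed)
  have sLb: "L \<inter> ball x r \<in> sets \<mu>" for x using clL by (auto simp: sets)
  have "continuous_on UNIV (\<lambda>x. int_op \<mu> L (\<lambda>y. \<kappa> (y - x)) (\<lambda>_. 1))"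
    using has_derivative_int_op[OF finite_measure_axioms sets clL unit_W_one]
    by (meson continuous_at_imp_continuous_on has_derivative_continuous)
  then have "continuous_on L ?K" by (intro continuous_intros) (rule continuous_on_subset, auto)
  then obtain x0 where x0: "x0 \<in> L" "\<And>x. x \<in> L \<Longrightarrow> ?K x0 \<le> ?K x"
    using continuous_attains_inf[OF L] by blast
  have int: "integrable \<mu> (\<lambda>y. indicator L y *\<^sub>R \<kappa> (y - x0))"
  proof (rule integrable_const_bound[of _ C])
    have "continuous_on L (\<lambda>y. \<kappa> (y - x0))" by (rule continuous_on_subset[OF continuous_shift]) auto
    then show "(\<lambda>y. indicator L y *\<^sub>R \<kappa> (y - x0)) \<in> borel_measurable \<mu>"
      using clL by (subst measurable_cong_sets[OF sets refl])
        (intro borel_measurable_continuous_on_indicator, auto)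
    show "AE y in \<mu>. norm (indicator L y *\<^sub>R \<kappa> (y - x0)) \<le> C"
      using bdd(1) C by (auto simp: indicator_def)
  qed
  have "c * measure \<mu> (L \<inter> ball x0 r) = (LINT y|\<mu>. c * indicator (L \<inter> ball x0 r) y)"
    using sLb by simp
  also have "\<dots> \<le> (LINT y:L|\<mu>. \<kappa> (y - x0))"
    unfolding set_lebesgue_integral_def
  proof (rule integral_mono)
    show "integrable \<mu> (\<lambda>y. c * indicator (L \<inter> ball x0 r) y)"
      using sLb by (auto simp: emeasure_eq_measure)
    show "c * indicator (L \<inter> ball x0 r) y \<le> indicator L y *\<^sub>R \<kappa> (y - x0)" for y
      using low[of "y - x0"] nonneg[of "y - x0"]
      by (auto simp: indicator_def dist_norm norm_minus_commute)
  qed (rule int)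
  finally have "c * measure \<mu> (L \<inter> ball x0 r) \<le> ?K x0"
    unfolding int_op_one_eq by simp
  moreover have "0 < measure \<mu> (L \<inter> ball x0 r)"
    using mass[OF x0(1)] by (simp add: zero_less_measure_iff)
  ultimately have "0 < ?K x0" using c(1) by (smt (verit) mult_pos_pos)
  then show ?thesis using x0(2) by blast
qed

section \<open>Both operators as quotients\<close>

lemma set_integral_uniform_measure:
  fixes F :: "'a \<Rightarrow> 'b::{banach, second_countable_topology}"
  assumes \<mu>: "finite_measure \<mu>" and L: "L \<in> sets \<mu>" "measure \<mu> L \<noteq> 0"
    and F: "(\<lambda>y. indicator L y *\<^sub>R F y) \<in> borel_measurable \<mu>"
  shows "(LINT y:L|uniform_measure \<mu> L. F y) = (LINT y:L|\<mu>. F y) /\<^sub>R measure \<mu> L"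
proof -
  interpret finite_measure \<mu> by fact
  have m: "0 < measure \<mu> L" using L(2) by (simp add: zero_less_measure_iff)
  have "uniform_measure \<mu> L = density \<mu> (\<lambda>y. ennreal (indicator L y / measure \<mu> L))"
    unfolding uniform_measure_def emeasure_eq_measure
    using m by (intro arg_cong[where f = "density \<mu>"] ext)
      (auto simp: divide_ennreal[symmetric] ennreal_indicator)
  then have "(LINT y:L|uniform_measure \<mu> L. F y)
      = (LINT y|\<mu>. (indicator L y / measure \<mu> L) *\<^sub>R (indicator L y *\<^sub>R F y))"
    unfolding set_lebesgue_integral_def using L F by (simp add: integral_density)
  also have "\<dots> = (LINT y|\<mu>. (indicator L y *\<^sub>R F y) /\<^sub>R measure \<mu> L)"
    by (intro Bochner_Integration.integral_cong) (auto simp: indicator_def divide_inverse)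
  also have "\<dots> = (LINT y|\<mu>. indicator L y *\<^sub>R F y) /\<^sub>R measure \<mu> L"
    by (rule integral_scaleR_right)
  finally show ?thesis by (simp only: set_lebesgue_integral_def)
qed

text \<open>Conditioning on \<open>L\<close> contributes the factor
  \<open>1 / measure \<mu> L\<close> to the outer integral and to \<open>Kh\<close>, and the two
  cancel.\<close>

lemma Qh_eq_int_op_quotient:
  fixes L :: "'a::euclidean_space set"
  assumes \<mu>: "prob_space \<mu>" and sets: "sets \<mu> = sets borel" and L: "closed L" "measure \<mu> L \<noteq> 0"
    and w: "\<And>x. continuous_on UNIV (\<lambda>y. kh k h (y - x))" and g: "unit_W L g"
  shows "Qh (uniform_measure \<mu> L) L k h g x =
      int_op \<mu> L (\<lambda>y. kh k h (y - x)) g / int_op \<mu> L (\<lambda>y. kh k h (y - x)) (\<lambda>_. 1)"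
proof -
  interpret prob_space \<mu> by fact
  have sL: "L \<in> sets \<mu>" using L by (simp add: sets)
  have m1: "(\<lambda>y. kh k h (y - x)) \<in> borel_measurable \<mu>"
    by (subst measurable_cong_sets[OF sets refl]) (rule borel_measurable_continuous_onI[OF w])
  let ?I = "LINT y:L|\<mu>. kh k h (y - x)"
  have K: "Kh (uniform_measure \<mu> L) L k h x = ?I / measure \<mu> L"
    unfolding Kh_def using m1 sL
    by (subst set_integral_uniform_measure[OF finite_measure_axioms sL L(2)]) (auto simp: divide_inverse mult.commute)
  have m2: "(\<lambda>y. complex_of_real r * complex_of_real (kh k h (y - x)) * (indicator L y *\<^sub>R g y)) \<in> borel_measurable \<mu>" for r
    using m1 borel_measurable_unit_W_indicator[OF sets L(1) g] by (intro borel_measurable_times) auto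
  let ?c = "measure \<mu> L / ?I"
  have "Qh (uniform_measure \<mu> L) L k h g x
      = (LINT y:L|uniform_measure \<mu> L. complex_of_real ?c * complex_of_real (kh k h (y - x)) * g y)"
    unfolding Qh_def qh_def K by (simp add: mult_ac)
  also have "\<dots> = (LINT y:L|\<mu>. complex_of_real ?c * complex_of_real (kh k h (y - x)) * g y) /\<^sub>R measure \<mu> L"
    using m2[of ?c] by (intro set_integral_uniform_measure[OF finite_measure_axioms sL L(2)]) simp
  also have "(LINT y:L|\<mu>. complex_of_real ?c * complex_of_real (kh k h (y - x)) * g y)
      = complex_of_real ?c * int_op \<mu> L (\<lambda>y. kh k h (y - x)) g"
    unfolding int_op_def by (subst set_integral_mult_right[symmetric]) (simp add: mult.assoc)
  finally show ?thesis
    using L(2) by (simp add: int_op_one_eq scaleR_conv_of_real)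
qed

lemma Pnt_int_estimated_level_set:
  "Pnt_int fhat X t n \<omega> (lev (fhat n (sample X n \<omega>)) t) u
    = (\<Sum>j\<in>Jn fhat X t n \<omega>. u (X j \<omega>)) /\<^sub>R real (card (Jn fhat X t n \<omega>))"
  unfolding Pnt_int_def by (auto simp: Jn_def lev_def intro!: arg_cong2[where f = scaleR] sum.cong)

lemma Qhat_eq_emp_op_quotient:
  assumes Om: "Omega_n f Df fhat Dfhat X t eps0 (eps n) n \<omega>" and n: "0 < n"
  shows "Qhat f Df fhat Dfhat X t eps0 eps k h phi n \<omega> g x =
      emp_op n (Jn fhat X t n \<omega>) (\<lambda>j. X j \<omega>) (inv (phi n)) (\<lambda>y. kh k h (y - phi n x)) g /
      emp_op n (Jn fhat X t n \<omega>) (\<lambda>j. X j \<omega>) (inv (phi n)) (\<lambda>y. kh k h (y - phi n x)) (\<lambda>_. 1)"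
proof -
  define J where "J = Jn fhat X t n \<omega>"
  have fin: "finite J" by (simp add: J_def Jn_def)
  define a where "a j = kh k h (X j \<omega> - phi n x)" for j
  define G where "G j = g (inv (phi n) (X j \<omega>))" for j
  define K where "K = (\<Sum>j\<in>J. a j) / real (card J)"
  have "Qhat f Df fhat Dfhat X t eps0 eps k h phi n \<omega> g x
      = (\<Sum>j\<in>J. complex_of_real (a j / K) * G j) /\<^sub>R real (card J)"
    using Om
    by (simp add: Qhat_def qnh_def Knh_def Pnt_int_estimated_level_set a_def G_def K_def J_def divide_inverse mult.commute)
  also have "\<dots> = (\<Sum>j\<in>J. complex_of_real (a j) * G j) / complex_of_real K / of_nat (card J)"
    by (simp add: scaleR_conv_of_real sum_divide_distrib divide_inverse mult_ac sum_distrib_left)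
  \<comment> \<open>The number of selected samples cancels. If no sample is selected, both sides are
    0 by the convention for division by zero.\<close>
  also have "\<dots> = (\<Sum>j\<in>J. complex_of_real (a j) * G j) / (\<Sum>j\<in>J. complex_of_real (a j))"
    using fin by (cases "J = {}") (auto simp: K_def)
  also have "\<dots> = ((\<Sum>j\<in>J. complex_of_real (a j) * G j) /\<^sub>R real n) / ((\<Sum>j\<in>J. complex_of_real (a j) * 1) /\<^sub>R real n)"
    using n by (simp add: scaleR_conv_of_real)
  finally show ?thesis by (simp add: emp_op_def a_def G_def J_def)
qed

section \<open>Convergence of the operators\<close>

text \<open>\<open>frechet_derivative\<close> within the level set is a choice of some derivative;
  uniqueness identifies it with the derivative \<open>A\<close> at hand, whose norm is read off on
  the unit ball.\<close>

lemma Wnorm_lev_le: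
  fixes f :: "'a::euclidean_space \<Rightarrow> real"
  assumes der: "\<And>x. (f has_derivative blinfun_apply (Df x)) (at x)"
    and reg: "\<And>x. f x = t \<Longrightarrow> Df x \<noteq> 0" and ne: "lev f t \<noteq> {}"
    and val: "\<And>x. x \<in> lev f t \<Longrightarrow> cmod (F x) \<le> b"
    and F': "\<And>x. x \<in> lev f t \<Longrightarrow>
      \<exists>A. (F has_derivative A) (at x within lev f t) \<and> (\<forall>v. norm v \<le> 1 \<longrightarrow> cmod (A v) \<le> b)"
  shows "Wnorm (lev f t) F \<le> b + b"
  unfolding Wnorm_def
proof (intro add_mono cSUP_least ne val)
  fix x assume x: "x \<in> lev f t"
  then obtain A where A: "(F has_derivative A) (at x within lev f t)" "\<And>v. norm v \<le> 1 \<Longrightarrow> cmod (A v) \<le> b"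
    using F' by blast
  have b: "0 \<le> b" using A(2)[of 0] norm_ge_zero[of "A 0"] by (simp del: norm_ge_zero)
  have bl: "bounded_linear A" using A(1) by (rule has_derivative_bounded_linear)
  have "frechet_derivative F (at x within lev f t) = A"
  proof (rule has_derivative_unique_superlevel[OF der])
    show "(F has_derivative frechet_derivative F (at x within lev f t)) (at x within {y. t \<le> f y})"
      using A(1) unfolding lev_def by (auto simp: frechet_derivative_works[symmetric] differentiable_def)
    show "(F has_derivative A) (at x within {y. t \<le> f y})" using A(1) by (simp add: lev_def)
  qed (use x reg in \<open>auto simp: lev_def\<close>)
  moreover have "norm (Blinfun A) \<le> b"
  proof (rule norm_blinfun_bound[OF b])
    fix v
    show "norm (Blinfun A v) \<le> b * norm v"
    proof (cases "v = 0")
      case False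
      have "A v = norm v *\<^sub>R A (sgn v)"
        using False bounded_linear.linear[OF bl] by (simp add: linear_scale[symmetric] sgn_div_norm)
      moreover have "norm v * cmod (A (sgn v)) \<le> norm v * b"
        using False A(2)[of "sgn v"] by (intro mult_left_mono) (auto simp: norm_sgn)
      ultimately show ?thesis
        using bl by (simp add: bounded_linear_Blinfun_apply mult.commute)
    qed (simp add: blinfun.zero_right)
  qed
  ultimately show "norm (Blinfun (frechet_derivative F (at x within lev f t))) \<le> b" by simp
qed

text \<open>Shows that the supremum defining the operator norm runs over a nonempty set.\<close>

lemma zero_in_unit_ball_W:
  fixes f :: "'a::euclidean_space \<Rightarrow> real"
  assumes der: "\<And>x. (f has_derivative blinfun_apply (Df x)) (at x)"
    and reg: "\<And>x. f x = t \<Longrightarrow> Df x \<noteq> 0" and ne: "lev f t \<noteq> {}"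
  shows "inW (lev f t) (\<lambda>_. 0)" and "Wnorm (lev f t) (\<lambda>_. 0) = 0"
proof -
  have fd: "frechet_derivative (\<lambda>_. 0 :: complex) (at x within lev f t) = (\<lambda>_. 0)" if "x \<in> lev f t" for x
    by (rule has_derivative_unique_superlevel[OF der, of t x "\<lambda>_. 0"])
       (use that reg in \<open>auto simp: lev_def frechet_derivative_works[symmetric]\<close>)
  have "continuous_on (lev f t) (\<lambda>x. Blinfun (frechet_derivative (\<lambda>_. 0 :: complex) (at x within lev f t)))"
    by (subst continuous_on_cong[OF refl, of _ _ "\<lambda>_. Blinfun (\<lambda>_. 0)"]) (auto simp: fd)
  moreover have "bounded ((\<lambda>x. Blinfun (frechet_derivative (\<lambda>_. 0 :: complex) (at x within lev f t))) ` lev f t)"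
    by (rule bounded_subset[of "{Blinfun (\<lambda>_. 0)}"]) (auto simp: fd)
  moreover have "bounded ((\<lambda>_. 0 :: complex) ` lev f t)"
    by (rule bounded_subset[of "{0}"]) auto
  ultimately show "inW (lev f t) (\<lambda>_. 0)"
    by (simp add: inW_def)
  have "Blinfun (\<lambda>_. 0) = 0" by (simp add: zero_blinfun.abs_eq)
  then show "Wnorm (lev f t) (\<lambda>_. 0) = 0"
    using ne by (simp add: Wnorm_def fd cong: SUP_cong_simp)
qed

text \<open>The quotient rule in the form that \<open>quotient_perturbation\<close>
  estimates.\<close>

lemma has_derivative_quotient:
  fixes a b :: "'a::real_normed_vector \<Rightarrow> complex"
  assumes "(a has_derivative a') (at x)" "(b has_derivative b') (at x)" "b x \<noteq> 0"
  shows "((\<lambda>x. a x / b x) has_derivative (\<lambda>v. (a' v - a x / b x * b' v) / b x)) (at x)"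
  using has_derivative_divide'[OF assms]
  by (rule has_derivative_eq_rhs) (use assms(3) in \<open>auto simp: field_simps\<close>)

text \<open>Continuity on a compact set bounds the family, so the real supremum really dominates its
  members.\<close>

lemma eventually_le_of_SUP_tendsto_0:
  fixes F :: "nat \<Rightarrow> 'a::topological_space \<Rightarrow> 'b::real_normed_vector"
  assumes K: "compact K" and cont: "\<And>n. continuous_on K (F n)"
    and lim: "(\<lambda>n. SUP x\<in>K. norm (F n x)) \<longlonglongrightarrow> 0" and \<delta>: "0 < \<delta>"
  shows "eventually (\<lambda>n. \<forall>x\<in>K. norm (F n x) < \<delta>) sequentially"
  using order_tendstoD(2)[OF lim \<delta>]
proof eventually_elim
  case (elim n)
  have "bdd_above ((\<lambda>x. norm (F n x)) ` K)"
    by (intro bounded_imp_bdd_above compact_imp_bounded compact_continuous_image continuous_intros cont K)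
  then show ?case using cSUP_upper elim by (metis (no_types, lifting) le_less_trans)
qed

theorem theorem1:
  fixes M :: "'w measure" and X :: "nat \<Rightarrow> 'w \<Rightarrow> 'a::euclidean_space"
    and f :: "'a \<Rightarrow> real" and Df :: "'a \<Rightarrow> 'a \<Rightarrow>\<^sub>L real"
    and D2f :: "'a \<Rightarrow> 'a \<Rightarrow>\<^sub>L 'a \<Rightarrow>\<^sub>L real"
    and t :: real
    and k :: "'a \<Rightarrow> real" and Dk :: "'a \<Rightarrow> 'a \<Rightarrow>\<^sub>L real"
    and D2k :: "'a \<Rightarrow> 'a \<Rightarrow>\<^sub>L 'a \<Rightarrow>\<^sub>L real"
    and h eps0 :: real and eps :: "nat \<Rightarrow> real"
    and phi :: "nat \<Rightarrow> 'a \<Rightarrow> 'a" and Dphi Dpsi :: "nat \<Rightarrow> 'a \<Rightarrow> 'a \<Rightarrow>\<^sub>L 'a"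
    and fhat :: "nat \<Rightarrow> 'a list \<Rightarrow> 'a \<Rightarrow> real"
    and Dfhat :: "nat \<Rightarrow> 'a list \<Rightarrow> 'a \<Rightarrow> 'a \<Rightarrow>\<^sub>L real"
  assumes
    \<comment> \<open>i.i.d. sample with Lebesgue density f\<close>
    P: "prob_space M"
    and iid: "prob_space.indep_vars M (\<lambda>_. lborel) X UNIV"
    and dens: "\<forall>i. distributed M lborel (X i) (\<lambda>x. ennreal (f x))"
    and f_nonneg: "\<forall>x. 0 \<le> f x"
    \<comment> \<open>the level t\<close>
    and t_pos: "0 < t" and t_int: "t \<in> interior (range f)"
    and L_ne: "lev f t \<noteq> {}" and L_cpt: "compact (lev f t)"
    and L_comp: "finite (components (lev f t))"
    \<comment> \<open>Assumption 1\<close>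
    and A1_Df: "\<forall>x. (f has_derivative blinfun_apply (Df x)) (at x)"
    and A1_D2f: "\<forall>x. (Df has_derivative blinfun_apply (D2f x)) (at x)"
    and A1_cont: "continuous_on UNIV D2f"
    and A1_grad: "\<forall>x. f x = t \<longrightarrow> 0 < norm (Df x)"
    and A1_bdd: "bounded (range f)" "bounded (range Df)" "bounded (range D2f)"
    \<comment> \<open>Assumption 2\<close>
    and A2_Dk: "\<forall>x. (k has_derivative blinfun_apply (Dk x)) (at x)"
    and A2_D2k: "\<forall>x. (Dk has_derivative blinfun_apply (D2k x)) (at x)"
    and A2_cont: "continuous_on UNIV D2k"
    and A2_nonneg: "\<forall>x. 0 \<le> k x"
    and A2_supp: "closure {x. k x \<noteq> 0} = cball 0 1"
    and A2_low: "\<exists>c>0. \<forall>x\<in>cball 0 (1/2). c \<le> k x"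
    and A2_sym: "\<forall>x. k (- x) = k x"
    \<comment> \<open>h and eps0\<close>
    and h_pos: "0 < h" and eps0_pos: "0 < eps0"
    and no_crit: "\<forall>x\<in>band f (t - eps0) (t + eps0). Df x \<noteq> 0"
    and eps0_h: "eps0 / Inf ((\<lambda>x. norm (Df x)) ` band f (t - eps0) t) < h / 2"
    \<comment> \<open>the sequence eps_n\<close>
    and eps_pos: "\<forall>n. 0 < eps n \<and> eps n \<le> eps0"
    and eps_lim: "eps \<longlonglongrightarrow> 0"
    \<comment> \<open>the C^1 diffeomorphisms phi_n\<close>
    and phi_bij: "\<forall>n. bij (phi n)"
    and phi_der: "\<forall>n x. (phi n has_derivative blinfun_apply (Dphi n x)) (at x)"
    and phi_C1: "\<forall>n. continuous_on UNIV (Dphi n)"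
    and phi_inv_der: "\<forall>n x. (inv (phi n) has_derivative blinfun_apply (Dpsi n x)) (at x)"
    and phi_inv_C1: "\<forall>n. continuous_on UNIV (Dpsi n)"
    and phi_L: "\<forall>n. phi n ` lev f t = lev f (t - eps n)"
    and phi_id: "(\<lambda>n. SUP x\<in>lev f t. norm (phi n x - x)) \<longlonglongrightarrow> 0"
    and Dphi_id: "(\<lambda>n. SUP x\<in>lev f t. norm (Dphi n x - id_blinfun)) \<longlonglongrightarrow> 0"
    \<comment> \<open>differentiable density estimate built from X_1..X_n\<close>
    and fhat_der: "\<forall>n xs x. (fhat n xs has_derivative blinfun_apply (Dfhat n xs x)) (at x)"
    \<comment> \<open>1_{Omega_n} \<rightarrow> 1 almost surely\<close>
    and Omega_as: "AE \<omega> in M. eventually (\<lambda>n. Omega_n f Df fhat Dfhat X t eps0 (eps n) n \<omega>) sequentially"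
  shows "AE \<omega> in M.
    (\<lambda>n. SUP g\<in>{g. inW (lev f t) g \<and> Wnorm (lev f t) g \<le> 1}.
        ereal (Wnorm (lev f t)
          (\<lambda>x. Qhat f Df fhat Dfhat X t eps0 eps k h phi n \<omega> g x
               - Qh (mut M X (lev f t)) (lev f t) k h g x)))
    \<longlonglongrightarrow> 0"
proof -
  interpret prob_space M by (rule P)
  let ?L = "lev f t"
  define \<mu> where "\<mu> = distr M lborel (X 0)"
  have dens_eq: "distr M lborel (X i) = density lborel (\<lambda>x. ennreal (f x))" for i
    using dens distributed_distr_eq_density by blast
  then have ident: "distr M lborel (X i) = \<mu>" for i by (simp add: \<mu>_def)
  have "X 0 \<in> measurable M lborel" using iid by (auto simp: indep_vars_def)
  then have \<mu>: "prob_space \<mu>" unfolding \<mu>_def by (rule prob_space_distr)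
  interpret \<mu>: prob_space \<mu> by (rule \<mu>)
  have sets: "sets \<mu> = sets borel" by (simp add: \<mu>_def)
  have cf: "continuous_on UNIV f" and cDf: "continuous_on UNIV Df"
    using A1_Df A1_D2f by (meson continuous_at_imp_continuous_on has_derivative_continuous)+
  have f_der: "(f has_derivative blinfun_apply (Df x)) (at x)" for x using A1_Df by blast
  have reg: "Df x \<noteq> 0" if "f x = t" for x using A1_grad that by force
  have clL: "closed ?L" using L_cpt by (rule compact_imp_closed)
  have fm: "f \<in> borel_measurable borel" using cf by (rule borel_measurable_continuous_onI)

  have null: "{x. f x = t} \<in> null_sets \<mu>"
  proof -
    have cl: "{x. f x = t} \<in> sets borel"
      by (intro borel_closed closed_Collect_eq continuous_intros cf)
    have "{x. f x = t} \<in> null_sets lebesgue"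
      using negligible_regular_level_set[OF f_der cDf reg] by (simp add: negligible_iff_null_sets)
    then have "{x. f x = t} \<in> null_sets lborel"
      using cl by (auto simp: null_sets_def)
    then have "AE x in lborel. x \<notin> {x. f x = t}" by (rule AE_not_in)
    then have "AE x in lborel. x \<in> {x. f x = t} \<longrightarrow> ennreal (f x) = 0" by eventually_elim simp
    then show ?thesis
      unfolding \<mu>_def dens_eq using cl fm by (subst null_sets_density_iff) simp_all
  qed

  have k0: "k x = 0" if "x \<notin> cball 0 1" for x
    using that closure_subset[of "{x. k x \<noteq> 0}"] unfolding A2_supp by blast
  obtain C D\<kappa> where "smooth_kernel (kh k h) D\<kappa> C"
    using rescaled_kernel_bounds[of k Dk D2k "cball 0 1" h, OF _ _ A2_cont compact_cball k0 h_pos]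
      A2_Dk A2_D2k unfolding smooth_kernel_def by metis
  then interpret smooth_kernel "kh k h" D\<kappa> C .
  let ?\<kappa> = "kh k h"

  obtain c where c: "0 < c" "\<And>x. x \<in> cball 0 (1/2) \<Longrightarrow> c \<le> k x" using A2_low by blast
  have low: "c \<le> ?\<kappa> x" if "norm x \<le> h / 2" for x
    unfolding kh_def using h_pos that by (intro c) (simp add: field_simps)
  \<comment> \<open>The part of the ball where \<open>f > t\<close> is open and nonempty, and the
    density there exceeds \<open>t > 0\<close>.\<close>
  have mass: "measure \<mu> (?L \<inter> ball x (h / 2)) \<noteq> 0" if x: "x \<in> ?L" for x
  proof -
    let ?U = "{z. t < f z} \<inter> ball x (h / 2)"
    have U: "open ?U" by (intro open_Int open_Collect_less continuous_intros cf) auto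
    have "?U \<noteq> {}"
      using superlevel_point_near[OF f_der cDf reg, of t x "h / 2"] x h_pos by (auto simp: lev_def)
    then have "emeasure \<mu> ?U \<noteq> 0"
      unfolding \<mu>_def dens_eq using t_pos by (intro measure_density_open_pos fm U) auto
    moreover have "measure \<mu> ?U \<le> measure \<mu> (?L \<inter> ball x (h / 2))"
      using U clL by (intro \<mu>.finite_measure_mono) (auto simp: lev_def sets)
    ultimately show ?thesis
      using measure_nonneg[of \<mu> ?U] unfolding \<mu>.emeasure_eq_measure ennreal_eq_0_iff by linarith
  qed
  have "0 < h / 2" "\<And>x. 0 \<le> ?\<kappa> x" using h_pos A2_nonneg by (auto simp: kh_def)
  from int_op_one_lower_bound[OF \<mu> sets L_cpt L_ne c(1) this(1) low this(2) mass]
  obtain c0 where c0: "0 < c0" "\<And>x. x \<in> ?L \<Longrightarrow> c0 \<le> cmod (int_op \<mu> ?L (\<lambda>y. ?\<kappa> (y - x)) (\<lambda>_. 1))"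
    by blast
  have massL: "measure \<mu> ?L \<noteq> 0"
  proof -
    obtain x where x: "x \<in> ?L" using L_ne by blast
    have "measure \<mu> (?L \<inter> ball x (h / 2)) \<le> measure \<mu> ?L"
      using clL by (intro \<mu>.finite_measure_mono) (auto simp: sets)
    with mass[OF x] measure_nonneg[of \<mu> "?L \<inter> ball x (h / 2)"] show ?thesis by linarith
  qed
  obtain B where B: "0 \<le> B"
    "\<And>s a a1 b b1 a' a1' b' b1'. \<lbrakk>0 \<le> s; s \<le> 1; c0 \<le> cmod b; c0 / 2 \<le> cmod b1;
        cmod a \<le> C; cmod a' \<le> C; cmod b' \<le> C;
        cmod (a1 - a) \<le> s; cmod (b1 - b) \<le> s; cmod (a1' - a') \<le> s; cmod (b1' - b') \<le> s\<rbrakk>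
      \<Longrightarrow> cmod (a1 / b1 - a / b) \<le> B * s \<and>
          cmod ((a1' - a1 / b1 * b1') / b1 - (a' - a / b * b') / b) \<le> B * s"
    by (rule quotient_perturbation[OF c0(1) C]) (rule that)

  have phi_ev: "eventually (\<lambda>n. \<forall>x\<in>?L. norm (phi n x - x) < \<delta>) sequentially" if "0 < \<delta>" for \<delta>
  proof (rule eventually_le_of_SUP_tendsto_0[OF L_cpt _ phi_id that])
    show "continuous_on ?L (\<lambda>x. phi n x - x)" for n
      using phi_der by (intro continuous_intros)
        (meson continuous_at_imp_continuous_on has_derivative_continuous)
  qed
  have Dphi_ev: "eventually (\<lambda>n. \<forall>x\<in>?L. norm (Dphi n x - id_blinfun) < \<delta>) sequentially" if "0 < \<delta>" for \<delta>
  proof (rule eventually_le_of_SUP_tendsto_0[OF L_cpt _ Dphi_id that])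
    show "continuous_on ?L (\<lambda>x. Dphi n x - id_blinfun)" for n
      using phi_C1 by (intro continuous_intros) (meson continuous_on_subset subset_UNIV)
  qed

  \<comment> \<open>The class with constant \<open>2 * C\<close> contains the shifted kernels and,
    for directions in the unit ball, their derivatives composed with \<open>Dphi n x\<close> once
    this is close to the identity.\<close>
  let ?unif = "\<lambda>\<eta> \<omega> n. \<forall>w g. (\<forall>y. \<bar>w y\<bar> \<le> 2 * C) \<longrightarrow> (\<forall>y z. \<bar>w y - w z\<bar> \<le> 2 * C * norm (y - z)) \<longrightarrow>
      unit_W ?L g \<longrightarrow>
      cmod (emp_op n (Jn fhat X t n \<omega>) (\<lambda>j. X j \<omega>) (inv (phi n)) w g - int_op \<mu> ?L w g) \<le> \<eta>"
  have "AE \<omega> in M. eventually (?unif (inverse (Suc m)) \<omega>) sequentially" for m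
    unfolding emp_op_def int_op_def \<mu>_def
  proof (rule AE_uniform_empirical_bound[OF iid _ cf L_cpt _ eps_lim _ _ phi_ev])
    show "AE \<omega> in M. eventually (\<lambda>n. \<forall>x. \<bar>fhat n (sample X n \<omega>) x - f x\<bar> \<le> eps n) sequentially"
      using Omega_as
    proof eventually_elim
      case (elim \<omega>)
      then show ?case by (rule eventually_mono) (simp add: Omega_n_def)
    qed
  qed (use ident null phi_bij phi_L C in \<open>auto simp: \<mu>_def\<close>)
  then have "AE \<omega> in M. \<forall>m. eventually (?unif (inverse (Suc m)) \<omega>) sequentially"
    by (subst AE_all_countable) blast
  then show ?thesis
    using Omega_as
  proof eventually_elim
    case (elim \<omega>)
    let ?Wd = "\<lambda>n g. Wnorm ?L (\<lambda>x. Qhat f Df fhat Dfhat X t eps0 eps k h phi n \<omega> g x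
               - Qh (mut M X ?L) ?L k h g x)"
    let ?ball = "{g. inW ?L g \<and> Wnorm ?L g \<le> 1}"
    have upper: "eventually (\<lambda>n. \<forall>g\<in>?ball. ?Wd n g \<le> e) sequentially" if e: "0 < e" for e
    proof -
      \<comment> \<open>The bound 1 is required by the perturbation estimate, \<open>c0 / 2\<close>
        keeps the empirical denominators away from zero, and the last bound makes the errors of
        value and derivative add up to at most \<open>e\<close>.\<close>
      define s where "s = min 1 (min (c0 / 2) (e / (2 * B + 1)))"
      have s: "0 < s" "s \<le> 1" "s \<le> c0 / 2" "s \<le> e / (2 * B + 1)"
        using c0(1) e B(1) unfolding s_def by (simp, simp, linarith, linarith)
      have Bs: "B * s + B * s \<le> e"
      proof -
        have "B * s + B * s \<le> s * (2 * B + 1)" using s(1) by (simp add: algebra_simps)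
        also have "\<dots> \<le> e" using s(4) B(1) by (simp add: le_divide_eq)
        finally show ?thesis .
      qed
      define \<eta> where "\<eta> = s / (3 * C + 1)"
      have \<eta>: "0 < \<eta>" "(3 * C + 1) * \<eta> = s" using s(1) C by (auto simp: \<eta>_def)
      have "\<eta> \<le> s" using mult_right_mono[of 1 "3 * C + 1" \<eta>] \<eta> C by simp
      then have \<eta>1: "\<eta> \<le> 1" using s by simp
      obtain m where m: "inverse (Suc m) < \<eta>" using reals_Archimedean[OF \<eta>(1)] by blast
      have "eventually (?unif (inverse (Suc m)) \<omega>) sequentially" using elim(1) by blast
      then show ?thesis
        using elim(2) phi_ev[OF \<eta>(1)] Dphi_ev[OF \<eta>(1)] eventually_gt_at_top[of 0]
      proof eventually_elim
        case (elim n)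
        let ?E = "emp_op n (Jn fhat X t n \<omega>) (\<lambda>j. X j \<omega>) (inv (phi n))"
        show ?case
        proof
          fix g assume "g \<in> ?ball"
          then have g: "unit_W ?L g" using inW_Wnorm_le_1_imp_unit_W by blast
          let ?N = "\<lambda>x. int_op \<mu> ?L (\<lambda>y. ?\<kappa> (y - x)) g"
          let ?D = "\<lambda>x. int_op \<mu> ?L (\<lambda>y. ?\<kappa> (y - x)) (\<lambda>_. 1)"
          let ?N1 = "\<lambda>x. ?E (\<lambda>y. ?\<kappa> (y - phi n x)) g"
          let ?D1 = "\<lambda>x. ?E (\<lambda>y. ?\<kappa> (y - phi n x)) (\<lambda>_. 1)"
          have "?Wd n g = Wnorm ?L (\<lambda>x. ?N1 x / ?D1 x - ?N x / ?D x)"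
            unfolding mut_def \<mu>_def[symmetric]
              Qhat_eq_emp_op_quotient[where eps = eps, OF elim(2,5)]
              Qh_eq_int_op_quotient[OF \<mu> sets clL massL continuous_shift g] ..
          also have "\<dots> \<le> B * s + B * s"
          proof (rule Wnorm_lev_le[OF f_der reg L_ne])
            fix x assume x: "x \<in> ?L"
            have close: "norm (phi n x - x) \<le> \<eta>" "norm (Dphi n x - id_blinfun) \<le> \<eta>"
              using elim(3,4) x by (auto intro: less_imp_le)
            \<comment> \<open>Stated for every test function in \<open>unit_W\<close>, since it is
              applied to \<open>g\<close> in the numerators and to 1 in the denominators.\<close>
            have bounds: "cmod (?E (\<lambda>y. ?\<kappa> (y - phi n x)) g' - int_op \<mu> ?L (\<lambda>y. ?\<kappa> (y - x)) g') \<le> s"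
                "norm v \<le> 1 \<Longrightarrow> cmod (?E (\<lambda>y. D\<kappa> (y - phi n x) (Dphi n x v)) g'
                    - int_op \<mu> ?L (\<lambda>y. D\<kappa> (y - x) v) g') \<le> s"
              if g': "unit_W ?L g'" for g' v
            proof -
              have un: "cmod (?E w g' - int_op \<mu> ?L w g') \<le> \<eta>"
                if "\<forall>y. \<bar>w y\<bar> \<le> 2 * C" "\<forall>y y'. \<bar>w y - w y'\<bar> \<le> 2 * C * norm (y - y')" for w
              proof -
                have "cmod (?E w g' - int_op \<mu> ?L w g') \<le> inverse (Suc m)"
                  using elim(1) that g' by blast
                then show ?thesis using m by linarith
              qed
              note b = emp_op_int_op_bounds[OF \<mu> sets clL g' less_imp_le[OF \<eta>(1)] \<eta>1 close, unfolded \<eta>(2)]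
              show "cmod (?E (\<lambda>y. ?\<kappa> (y - phi n x)) g' - int_op \<mu> ?L (\<lambda>y. ?\<kappa> (y - x)) g') \<le> s"
                by (rule b(1)) (rule un; blast)
              show "cmod (?E (\<lambda>y. D\<kappa> (y - phi n x) (Dphi n x v)) g'
                    - int_op \<mu> ?L (\<lambda>y. D\<kappa> (y - x) v) g') \<le> s" if "norm v \<le> 1"
                by (rule b(2)[OF _ that]) (rule un; blast)
            qed
            note N = bounds(1)[OF g] and D = bounds(1)[OF unit_W_one]
            have D1: "c0 / 2 \<le> cmod (?D1 x)"
              using norm_triangle_ineq2[of "?D x" "?D x - ?D1 x"] D c0(2)[OF x] s(3)
              by (simp add: norm_minus_commute)
            let ?N' = "\<lambda>v. - int_op \<mu> ?L (\<lambda>y. D\<kappa> (y - x) v) g"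
            let ?D' = "\<lambda>v. - int_op \<mu> ?L (\<lambda>y. D\<kappa> (y - x) v) (\<lambda>_. 1)"
            let ?N1' = "\<lambda>v. - ?E (\<lambda>y. D\<kappa> (y - phi n x) (Dphi n x v)) g"
            let ?D1' = "\<lambda>v. - ?E (\<lambda>y. D\<kappa> (y - phi n x) (Dphi n x v)) (\<lambda>_. 1)"
            have N': "cmod (?N1' v - ?N' v) \<le> s" if "norm v \<le> 1" for v
              using bounds(2)[OF g that] by (simp add: norm_minus_commute)
            have D': "cmod (?D1' v - ?D' v) \<le> s" if "norm v \<le> 1" for v
              using bounds(2)[OF unit_W_one that] by (simp add: norm_minus_commute)
            have Dv: "\<bar>D\<kappa> y v\<bar> \<le> C" if "norm v \<le> 1" for y v
              using D_apply_le[of y v] mult_left_mono[OF that C] by linarith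
            have bd: "cmod (?N x) \<le> C"
              by (rule int_op_bound[OF \<mu> sets clL g continuous_shift bdd(1)])
            have bd': "cmod (?N' v) \<le> C" "cmod (?D' v) \<le> C" if "norm v \<le> 1" for v
              unfolding norm_minus_cancel
              by (rule int_op_bound[OF \<mu> sets clL _ continuous_D_shift Dv[OF that]], intro g unit_W_one)+
            have pert: "cmod (?N1 x / ?D1 x - ?N x / ?D x) \<le> B * s \<and>
                cmod ((?N1' v - ?N1 x / ?D1 x * ?D1' v) / ?D1 x - (?N' v - ?N x / ?D x * ?D' v) / ?D x) \<le> B * s"
              if v: "norm v \<le> 1" for v
              by (rule B(2)[OF less_imp_le[OF s(1)] s(2) c0(2)[OF x] D1 bd bd'[OF v] N D N'[OF v] D'[OF v]])
            \<comment> \<open>The estimate of the values does not involve the direction, so any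
              admissible one will do.\<close>
            show "cmod (?N1 x / ?D1 x - ?N x / ?D x) \<le> B * s"
              using pert[of 0] by simp
            let ?A = "\<lambda>v. (?N1' v - ?N1 x / ?D1 x * ?D1' v) / ?D1 x - (?N' v - ?N x / ?D x * ?D' v) / ?D x"
            have "?D1 x \<noteq> 0" "?D x \<noteq> 0" using D1 c0 x by force+
            then have "((\<lambda>x. ?N1 x / ?D1 x - ?N x / ?D x) has_derivative ?A) (at x)"
              using phi_der
              by (intro has_derivative_diff has_derivative_quotient has_derivative_emp_op
                    has_derivative_int_op[OF \<mu>.finite_measure_axioms sets clL] g unit_W_one) auto
            then have "((\<lambda>x. ?N1 x / ?D1 x - ?N x / ?D x) has_derivative ?A) (at x within ?L)"
              by (rule has_derivative_at_withinI)
            moreover have "cmod (?A v) \<le> B * s" if "norm v \<le> 1" for v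
              using pert[OF that] by blast
            ultimately show "\<exists>A. ((\<lambda>x. ?N1 x / ?D1 x - ?N x / ?D x) has_derivative A) (at x within ?L)
                \<and> (\<forall>v. norm v \<le> 1 \<longrightarrow> cmod (A v) \<le> B * s)" by blast
          qed
          finally show "?Wd n g \<le> e" using Bs by linarith
        qed
      qed
    qed
    \<comment> \<open>In \<open>ereal\<close> a supremum over the empty set would be minus infinity;
      the zero function supplies the value 0.\<close>
    have lower: "0 \<le> (SUP g\<in>?ball. ereal (?Wd n g))" for n
    proof (rule SUP_upper2)
      show "(\<lambda>_. 0) \<in> ?ball"
        using zero_in_unit_ball_W[OF f_der reg L_ne] by simp
      have "Qhat f Df fhat Dfhat X t eps0 eps k h phi n \<omega> (\<lambda>_. 0) x
          - Qh (mut M X ?L) ?L k h (\<lambda>_. 0) x = 0" for x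
        by (simp add: Qhat_def Qh_def Pnt_int_def)
      then show "0 \<le> ereal (?Wd n (\<lambda>_. 0))"
        using zero_in_unit_ball_W(2)[OF f_der reg L_ne] by simp
    qed
    show ?case
    proof (rule order_tendstoI)
      fix a :: ereal assume "a < 0"
      then show "\<forall>\<^sub>F n in sequentially. a < (SUP g\<in>?ball. ereal (?Wd n g))"
        using lower by (intro always_eventually allI) (meson less_le_trans)
    next
      fix a :: ereal assume "0 < a"
      then obtain e where e: "0 < ereal e" "ereal e < a" using ereal_dense2 by blast
      then have "0 < e" by simp
      from upper[OF this] show "\<forall>\<^sub>F n in sequentially. (SUP g\<in>?ball. ereal (?Wd n g)) < a"
      proof eventually_elim
        case (elim n)
        then have "(SUP g\<in>?ball. ereal (?Wd n g)) \<le> ereal e" by (intro SUP_least) auto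
        then show ?case using e(2) by (rule le_less_trans)
      qed
    qed
  qed
qed

end
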